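(* Let $\alpha>-1$ and $S_0>0$. Let $V=V(y,s)\in C^2_xC^1_t(\mathbb{R}^{3+1})$, with values in $\mathbb{R}^3$, be a time periodic solution with period $S_0$ (that is, $V(y,s+S_0)=V(y,s)$ for all $(y,s)\in\mathbb{R}^3\times\mathbb{R}$) of the system $$\frac{\partial V}{\partial s}+\frac{\alpha}{\alpha+1}V+\frac{1}{\alpha+1}(y\cdot\nabla)V+(V\cdot\nabla)V=-\nabla P,\qquad \operatorname{div}V=0\qquad\text{in }\mathbb{R}^3\times\mathbb{R},$$ for some scalar function $P=P(y,s)$. Suppose that $V$ has bounded first derivatives, that $$\lim_{|y|\to\infty}V(y,s)=0\quad\text{for all } s\in[0,S_0),$$ and that, for some $r>0$, $$\Omega:=\operatorname{curl}V\in\bigcap_{0<q<r}L^q(\mathbb{R}^3\times[0,S_0]).$$ Then $V=0$ on $\mathbb{R}^{3+1}$.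
   Context: Here $(y,s)\in\mathbb{R}^3\times\mathbb{R}=\mathbb{R}^{3+1}$; $\nabla$, $\operatorname{div}$, $\operatorname{curl}$ are taken with respect to the space variable $y$. The class $C^2_xC^1_t$ means twice continuously differentiable in the space variable $y$ and once continuously differentiable in the time variable $s$. For $0<q<1$, $f\in L^q$ means that $f$ is measurable and $\int|f|^q<\infty$. (The system is the self-similar form of the 3D incompressible Euler equations, and $s$-periodic solutions correspond to discretely self-similar Euler solutions.) *)

theory Defs
  imports "HOL-Analysis.Analysis"
begin

text \<open>A space-time field is a curried function of the space variable \<open>y\<close> and the time \<open>s\<close>;
  \<open>grad\<close>, \<open>divergence\<close>, \<open>curl\<close> act on a function of the space variable alone.\<close>

text \<open>All derivatives of order at most two in space and one in time exist and are
  jointly continuous in space-time. Continuity of \<open>V\<close> itself then follows.\<close>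

definition C2x_C1t :: "(real^3 \<Rightarrow> real \<Rightarrow> real^3) \<Rightarrow> bool" where
  "C2x_C1t V \<longleftrightarrow>
    (\<exists>(Vs :: real^3 \<Rightarrow> real \<Rightarrow> real^3)
      (DV :: real^3 \<Rightarrow> real \<Rightarrow> ((real^3) \<Rightarrow>\<^sub>L (real^3)))
      (D2V :: real^3 \<Rightarrow> real \<Rightarrow> ((real^3) \<Rightarrow>\<^sub>L ((real^3) \<Rightarrow>\<^sub>L (real^3)))).
      (\<forall>y s. ((\<lambda>t. V y t) has_vector_derivative Vs y s) (at s)) \<and>
      (\<forall>y s. ((\<lambda>x. V x s) has_derivative blinfun_apply (DV y s)) (at y)) \<and>
      (\<forall>y s. ((\<lambda>x. DV x s) has_derivative blinfun_apply (D2V y s)) (at y)) \<and>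
      continuous_on UNIV (\<lambda>(y, s). Vs y s) \<and>
      continuous_on UNIV (\<lambda>(y, s). DV y s) \<and>
      continuous_on UNIV (\<lambda>(y, s). D2V y s))"

definition partial :: "3 \<Rightarrow> (real^3 \<Rightarrow> 'b::real_normed_vector) \<Rightarrow> real^3 \<Rightarrow> 'b" where
  "partial j f y = frechet_derivative f (at y) (axis j 1)"

definition grad :: "(real^3 \<Rightarrow> real) \<Rightarrow> real^3 \<Rightarrow> real^3" where
  "grad f y = (\<chi> j. partial j f y)"

definition divergence :: "(real^3 \<Rightarrow> real^3) \<Rightarrow> real^3 \<Rightarrow> real" where
  "divergence U y = (\<Sum>j\<in>UNIV. partial j U y $ j)"

definition curl :: "(real^3 \<Rightarrow> real^3) \<Rightarrow> real^3 \<Rightarrow> real^3" where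
  "curl U y = vector
    [partial 2 U y $ 3 - partial 3 U y $ 2,
     partial 3 U y $ 1 - partial 1 U y $ 3,
     partial 1 U y $ 2 - partial 2 U y $ 1]"

text \<open>The directional derivative \<open>(w \<cdot> \<nabla>) U\<close> at \<open>y\<close>.\<close>

definition advect :: "real^3 \<Rightarrow> (real^3 \<Rightarrow> real^3) \<Rightarrow> real^3 \<Rightarrow> real^3" where
  "advect w U y = (\<Sum>j\<in>UNIV. (w $ j) *\<^sub>R partial j U y)"

text \<open>The pressure is only required to be differentiable in space, so that \<open>grad\<close> is meaningful.\<close>

definition self_similar_euler ::
  "real \<Rightarrow> (real^3 \<Rightarrow> real \<Rightarrow> real^3) \<Rightarrow> (real^3 \<Rightarrow> real \<Rightarrow> real) \<Rightarrow> bool" where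
  "self_similar_euler \<alpha> V P \<longleftrightarrow>
    (\<forall>y s. (\<lambda>x. P x s) differentiable (at y)) \<and>
    (\<forall>y s. vector_derivative (\<lambda>t. V y t) (at s)
            + (\<alpha> / (\<alpha> + 1)) *\<^sub>R V y s
            + (1 / (\<alpha> + 1)) *\<^sub>R advect y (\<lambda>x. V x s) y
            + advect (V y s) (\<lambda>x. V x s) y
          = - grad (\<lambda>x. P x s) y) \<and>
    (\<forall>y s. divergence (\<lambda>x. V x s) y = 0)"

text \<open>Membership in \<open>L\<^sup>q(S)\<close> for any exponent \<open>q > 0\<close>, including \<open>q < 1\<close>.\<close>

definition in_Lq :: "real \<Rightarrow> 'a::euclidean_space set \<Rightarrow> ('a \<Rightarrow> 'b::euclidean_space) \<Rightarrow> bool" where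
  "in_Lq q S f \<longleftrightarrow>
    f \<in> borel_measurable (lebesgue_on S) \<and>
    integrable (lebesgue_on S) (\<lambda>x. norm (f x) powr q)"

end

theory Submission
  imports Defs
begin

text \<open>
  The antisymmetric part \<open>W\<close> of \<open>\<nabla>V\<close> (the vorticity) satisfies
  \<open>W\<^sub>s + W + b \<cdot> \<nabla>W = O(\<bar>\<nabla>V\<bar> \<bar>W\<bar>)\<close> with the drift \<open>b = y / (\<alpha> + 1) + V\<close>, of divergence
  \<open>3 / (\<alpha> + 1)\<close>. Integrating the equation of \<open>\<bar>W\<bar>\<^sup>q\<close> over one period gives
  \<open>3 / (\<alpha> + 1) \<integral>\<bar>W\<bar>\<^sup>q \<le> K q \<integral>\<bar>W\<bar>\<^sup>q\<close> with \<open>K\<close> independent of \<open>q\<close>, so that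
  \<open>W = 0\<close> by letting \<open>q\<close> be small. Then \<open>V\<close> is curl free and divergence free, hence harmonic, and
  it vanishes by the maximum principle.
\<close>

subsection \<open>Symmetry of second derivatives\<close>

text \<open>Why a small exponent wins: raising the squared vorticity to the power
  \<open>p = q / 2\<close> puts a factor \<open>p\<close> in front of the damping and stretching
  terms, whereas the divergence of the drift enters through the product rule for the flux and
  carries no such factor. Two obstacles shape the argument. A small power is not differentiable
  where the vorticity vanishes, so \<open>x powr p\<close> is replaced by
  \<open>(x + e) powr p - e powr p\<close>, which is differentiable on the closed half-line,
  vanishes at 0 and stays below \<open>x powr p\<close>. And the drift grows linearly, so the
  integration by parts needs a cutoff. Its gradient is of order \<open>1 / R\<close> on a ball of
  radius \<open>R\<close> and vanishes outside; the product with the drift therefore stays bounded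
  and tends to 0 at each point, and dominated convergence removes it. Working with the antisymmetric
  part of the gradient instead of the curl avoids cross products; dimension three returns only when
  the result is applied.\<close>

lemma second_difference_tendsto:
  fixes f :: "'a::real_normed_vector \<Rightarrow> real"
  assumes f: "\<And>x. (f has_derivative f' x) (at x)"
    and D: "((\<lambda>x. f' x u) has_derivative D) (at y)"
  shows "((\<lambda>t. (f (y + t *\<^sub>R u + t *\<^sub>R v) - f (y + t *\<^sub>R u) - f (y + t *\<^sub>R v) + f y) / t\<^sup>2)
           \<longlongrightarrow> D v) (at_right 0)"
proof (rule tendstoI)
  fix e :: real assume e: "e > 0"
  let ?N = "norm u + norm v + 1"
  have N: "?N > 0" by (simp add: add_nonneg_pos)
  \<comment> \<open>Two first-order expansions are used below, each with error at most
    \<open>e' * (t * ?N)\<close>; together they cost \<open>t * e / 2\<close>, strictly less than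
    \<open>t * e\<close>.\<close>
  define e' where "e' = e / (4 * ?N)"
  have e': "e' > 0" using e N by (simp add: e'_def)
  interpret D: bounded_linear D using D by (rule has_derivative_bounded_linear)
  obtain d where d: "d > 0"
    and dd: "\<And>z. norm (z - y) < d \<Longrightarrow> norm (f' z u - f' y u - D (z - y)) \<le> e' * norm (z - y)"
    using D e' unfolding has_derivative_at_alt by blast
  have "dist ((f (y + t *\<^sub>R u + t *\<^sub>R v) - f (y + t *\<^sub>R u) - f (y + t *\<^sub>R v) + f y) / t\<^sup>2) (D v) < e"
    if t: "0 < t" "t < d / ?N" for t
  proof -
    \<comment> \<open>The increment in direction \<open>v\<close> is followed along
      \<open>u\<close>. The mean value theorem in \<tau> leaves a difference of two values of
      \<open>f'\<close>, both of which are then expanded around the one point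
      \<open>y\<close>.\<close>
    define g where "g = (\<lambda>\<tau>. f (y + \<tau> *\<^sub>R u + t *\<^sub>R v) - f (y + \<tau> *\<^sub>R u))"
    have g: "(g has_derivative
        (\<lambda>h. f' (y + \<tau> *\<^sub>R u + t *\<^sub>R v) (h *\<^sub>R u) - f' (y + \<tau> *\<^sub>R u) (h *\<^sub>R u))) (at \<tau>)" for \<tau>
      unfolding g_def
      by (rule has_derivative_diff; rule has_derivative_compose[OF _ f])
         (auto intro!: derivative_eq_intros)
    obtain x where x: "x \<in> {0<..<t}"
      and gx: "g t - g 0 = f' (y + x *\<^sub>R u + t *\<^sub>R v) (t *\<^sub>R u) - f' (y + x *\<^sub>R u) (t *\<^sub>R u)"
      using mvt_simple[of 0 t g, OF t(1) has_derivative_at_withinI[OF g]] by auto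
    have gxt: "g t - g 0 = t * (f' (y + x *\<^sub>R u + t *\<^sub>R v) u - f' (y + x *\<^sub>R u) u)"
      unfolding gx using has_derivative_linear[OF f] by (simp add: linear_cmul algebra_simps)
    have n1: "norm (x *\<^sub>R u + t *\<^sub>R v) \<le> t * ?N"
    proof -
      have "norm (x *\<^sub>R u + t *\<^sub>R v) \<le> x * norm u + t * norm v"
        using norm_triangle_ineq[of "x *\<^sub>R u" "t *\<^sub>R v"] x t by simp
      also have "\<dots> \<le> t * norm u + t * norm v"
        using x by (intro add_mono mult_right_mono) auto
      finally show ?thesis using t by (simp add: algebra_simps)
    qed
    have n2: "norm (x *\<^sub>R u) \<le> t * ?N"
    proof -
      have "norm (x *\<^sub>R u) \<le> t * norm u" using x by (auto intro!: mult_right_mono)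
      also have "\<dots> \<le> t * ?N" using t by (intro mult_left_mono) auto
      finally show ?thesis .
    qed
    have tN: "t * ?N < d" using t N by (simp add: field_simps)
    have a1: "norm (f' (y + x *\<^sub>R u + t *\<^sub>R v) u - f' y u - D (x *\<^sub>R u + t *\<^sub>R v)) \<le> e' * (t * ?N)"
      using dd[of "y + x *\<^sub>R u + t *\<^sub>R v"] n1 tN mult_left_mono[OF n1, of e'] e'
      by (simp add: algebra_simps)
    have a2: "norm (f' (y + x *\<^sub>R u) u - f' y u - D (x *\<^sub>R u)) \<le> e' * (t * ?N)"
      using dd[of "y + x *\<^sub>R u"] n2 tN mult_left_mono[OF n2, of e'] e'
      by (simp add: algebra_simps)
    have "\<bar>f' (y + x *\<^sub>R u + t *\<^sub>R v) u - f' (y + x *\<^sub>R u) u - t * D v\<bar> \<le> 2 * (e' * (t * ?N))"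
      using a1 a2 by (simp add: D.add D.scaleR abs_le_iff)
    also have "\<dots> = 2 * t * (e' * ?N)" by simp
    also have "e' * ?N = e / 4"
    proof -
      have "e / (4 * x) * x = e / 4" if "x > 0" for x :: real using that by simp
      from this[OF N] show ?thesis by (simp only: e'_def)
    qed
    also have "2 * t * (e / 4) < t * e" using e t by simp
    finally have b: "\<bar>f' (y + x *\<^sub>R u + t *\<^sub>R v) u - f' (y + x *\<^sub>R u) u - t * D v\<bar> < t * e" .
    have "dist ((g t - g 0) / t\<^sup>2) (D v)
        = \<bar>f' (y + x *\<^sub>R u + t *\<^sub>R v) u - f' (y + x *\<^sub>R u) u - t * D v\<bar> / t"
    proof -
      have "t * x / t\<^sup>2 - c = (x - t * c) / t" for x c
        using t by (simp add: power2_eq_square field_simps)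
      then show ?thesis unfolding gxt dist_real_def using t by (simp add: abs_divide)
    qed
    also have "\<dots> < e" using b t by (simp add: field_simps)
    finally show ?thesis by (simp add: g_def algebra_simps)
  qed
  moreover have "0 < d / ?N" using d N by simp
  ultimately show "\<forall>\<^sub>F t in at_right 0. dist ((f (y + t *\<^sub>R u + t *\<^sub>R v) - f (y + t *\<^sub>R u)
      - f (y + t *\<^sub>R v) + f y) / t\<^sup>2) (D v) < e"
    by (auto simp: eventually_at_right[OF \<open>0 < d / ?N\<close>] intro!: exI[of _ "d / ?N"])
qed

text \<open>The second difference does not change when \<open>u\<close> and \<open>v\<close> are
  exchanged, and its limits computed in the two orders are the two mixed derivatives. Pairing with
  an arbitrary \<open>w\<close> reduces to scalar functions.\<close>

lemma symmetric_second_derivative: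
  fixes f :: "'a::real_normed_vector \<Rightarrow> 'b::real_inner"
  assumes f: "\<And>x. (f has_derivative blinfun_apply (f' x)) (at x)"
    and D: "(f' has_derivative D) (at y)"
  shows "blinfun_apply (D u) v = blinfun_apply (D v) u"
proof (rule vector_eq_rdot[THEN iffD1], rule allI)
  fix w
  have F: "((\<lambda>x. f x \<bullet> w) has_derivative (\<lambda>h. blinfun_apply (f' x) h \<bullet> w)) (at x)" for x
    by (rule has_derivative_inner_left[OF f])
  have E: "((\<lambda>x. blinfun_apply (f' x) h \<bullet> w) has_derivative (\<lambda>k. blinfun_apply (D k) h \<bullet> w)) (at y)" for h
    by (rule has_derivative_inner_left)
       (rule bounded_linear.has_derivative[OF blinfun.bounded_linear_left D])
  have 1: "((\<lambda>t. (f (y + t *\<^sub>R v + t *\<^sub>R u) \<bullet> w - f (y + t *\<^sub>R v) \<bullet> w - f (y + t *\<^sub>R u) \<bullet> w + f y \<bullet> w) / t\<^sup>2)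
     \<longlongrightarrow> blinfun_apply (D u) v \<bullet> w) (at_right 0)"
    by (rule second_difference_tendsto[OF F E])
  have 2: "((\<lambda>t. (f (y + t *\<^sub>R v + t *\<^sub>R u) \<bullet> w - f (y + t *\<^sub>R v) \<bullet> w - f (y + t *\<^sub>R u) \<bullet> w + f y \<bullet> w) / t\<^sup>2)
     \<longlongrightarrow> blinfun_apply (D v) u \<bullet> w) (at_right 0)"
    using second_difference_tendsto[OF F E, of u v]
    by (simp add: algebra_simps)
  show "blinfun_apply (D u) v \<bullet> w = blinfun_apply (D v) u \<bullet> w"
    using tendsto_unique[OF _ 1 2] by simp
qed

lemma integral_along_segment:
  fixes F :: "'a::real_normed_vector \<Rightarrow> 'b::topological_space \<Rightarrow> 'c::banach"
  assumes F: "\<And>x s. ((\<lambda>x. F x s) has_derivative blinfun_apply (F' x s)) (at x)"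
  shows "((\<lambda>t. blinfun_apply (F' (t *\<^sub>R y) s) y) has_integral (F y s - F 0 s)) (cbox (0::real) 1)"
proof -
  have "((\<lambda>t. F (t *\<^sub>R y) s) has_vector_derivative blinfun_apply (F' (t *\<^sub>R y) s) y) (at t within {0..1})" for t
  proof -
    have "((\<lambda>t. F (t *\<^sub>R y) s) has_derivative (\<lambda>h. blinfun_apply (F' (t *\<^sub>R y) s) (h *\<^sub>R y))) (at t)"
      by (rule has_derivative_compose[OF _ F]) (auto intro!: derivative_eq_intros)
    then show ?thesis
      by (simp add: has_vector_derivative_def blinfun.scaleR_right has_derivative_at_withinI)
  qed
  from fundamental_theorem_of_calculus[OF zero_le_one this]
  show ?thesis by simp
qed

text \<open>The increment is the integral of \<open>F'\<close> along the segment from 0 to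
  \<open>y\<close>, a parameter integral that inherits joint continuity. Increments are considered
  because \<open>F 0 s\<close> may depend on \<open>s\<close> in an arbitrary way, as it does for
  the pressure.\<close>

lemma continuous_on_difference_joint:
  fixes F :: "'a::real_normed_vector \<Rightarrow> 'b::topological_space \<Rightarrow> 'c::banach"
  assumes F: "\<And>x s. ((\<lambda>x. F x s) has_derivative blinfun_apply (F' x s)) (at x)"
    and c: "continuous_on UNIV (\<lambda>(x, s). F' x s)"
  shows "continuous_on UNIV (\<lambda>(y, s). F y s - F 0 s)"
proof -
  note [continuous_intros] = continuous_on_compose2[OF c, of _ "\<lambda>x. (f x, g x)" for f g, simplified]
  have "continuous_on UNIV (\<lambda>z. integral (cbox (0::real) 1) ((\<lambda>z t. blinfun_apply (F' (t *\<^sub>R fst z) (snd z)) (fst z)) z))"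
    by (rule integral_continuous_on_param) (auto simp: split_beta intro!: continuous_intros)
  then show ?thesis
    unfolding split_beta integral_unique[OF integral_along_segment[of F F', OF F]] .
qed

subsection \<open>Evolution of the vorticity\<close>

text \<open>\<open>Vs\<close> need not be differentiable in space. The time integral of \<open>P y s - P 0 s\<close> however has
  the differentiable gradient \<open>G\<close>, and the symmetry of its Hessian is the vorticity equation
  integrated in time; subtracting \<open>P 0 s\<close> is needed since \<open>P\<close> may be irregular in time.\<close>

lemma antisymmetric_part_time_derivative:
  fixes V A Vs :: "'a::euclidean_space \<Rightarrow> real \<Rightarrow> 'a" and P :: "'a \<Rightarrow> real \<Rightarrow> real"
  assumes V: "\<And>y s. ((\<lambda>x. V x s) has_derivative blinfun_apply (DV y s)) (at y)"
    and A: "\<And>y s. ((\<lambda>x. A x s) has_derivative blinfun_apply (DA y s)) (at y)"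
    and Vs: "\<And>y s. ((\<lambda>t. V y t) has_vector_derivative Vs y s) (at s)"
    and P: "\<And>y s. ((\<lambda>x. P x s) has_derivative (\<lambda>h. - (Vs y s + A y s) \<bullet> h)) (at y)"
    and cVs: "continuous_on UNIV (\<lambda>(y, s). Vs y s)"
    and cA: "continuous_on UNIV (\<lambda>(y, s). A y s)"
    and cDA: "continuous_on UNIV (\<lambda>(y, s). DA y s)"
  shows "((\<lambda>t. DV y t u \<bullet> v - DV y t v \<bullet> u) has_real_derivative
           - (DA y s u \<bullet> v - DA y s v \<bullet> u)) (at s)"
proof -
  note [continuous_intros] =
    continuous_on_compose2[OF cVs, of _ "\<lambda>x. (f x, g x)" for f g, simplified]
    continuous_on_compose2[OF cA, of _ "\<lambda>x. (f x, g x)" for f g, simplified]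
    continuous_on_compose2[OF cDA, of _ "\<lambda>x. (f x, g x)" for f g, simplified]
  define g where "g = (\<lambda>y s. - (Vs y s + A y s))"
  define g' where "g' = (\<lambda>y s. blinfun_inner_left (g y s))"
  have cg': "continuous_on UNIV (\<lambda>(y, s). g' y s)"
    unfolding g'_def g_def split_beta
    by (intro bounded_linear.continuous_on[OF bounded_linear_blinfun_inner_left] continuous_intros)
  have P': "((\<lambda>x. P x s) has_derivative blinfun_apply (g' y s)) (at y)" for y s
    using P[of s y] by (simp add: g'_def g_def inner_commute)
  have cp: "continuous_on UNIV (\<lambda>(y, s). P y s - P 0 s)"
    by (rule continuous_on_difference_joint[OF P' cg'])
  note [continuous_intros] =
    continuous_on_compose2[OF cp, of _ "\<lambda>x. (f x, g x)" for f g, simplified]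
  let ?w = "\<lambda>t. DV y t u \<bullet> v - DV y t v \<bullet> u"
  let ?c = "\<lambda>t. DA y t u \<bullet> v - DA y t v \<bullet> u"
  have main: "?w b - ?w a = - integral {a..b} ?c" if ab: "a \<le> b" for a b
  proof -
    define Q where "Q = (\<lambda>y. integral (cbox a b) (\<lambda>s. P y s - P 0 s))"
    define G where "G = (\<lambda>y. - (V y b - V y a) - integral (cbox a b) (A y))"
    have intg: "integral (cbox a b) (g x) = G x" for x
    proof -
      have 1: "(Vs x has_integral (V x b - V x a)) (cbox a b)"
        using fundamental_theorem_of_calculus[OF ab, of "V x" "Vs x"] Vs
        by (simp add: has_vector_derivative_at_within)
      have 2: "(A x has_integral integral (cbox a b) (A x)) (cbox a b)"
        by (intro integrable_integral integrable_continuous continuous_intros)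
      show ?thesis
        using integral_unique[OF has_integral_neg[OF has_integral_add[OF 1 2]]]
        by (simp add: G_def g_def)
    qed
    have Q: "(Q has_derivative blinfun_apply (blinfun_inner_left (G x))) (at x)" for x
    proof -
      have "(Q has_derivative blinfun_apply (integral (cbox a b) (g' x))) (at x within UNIV)"
        unfolding Q_def
      proof (rule leibniz_rule)
        show "((\<lambda>x. P x t - P 0 t) has_derivative blinfun_apply (g' x t)) (at x within UNIV)" for x t
          using has_derivative_diff[OF P'[of t x] has_derivative_const] by simp
        show "(\<lambda>s. P x s - P 0 s) integrable_on cbox a b" for x
          by (intro integrable_continuous continuous_intros)
        show "continuous_on (UNIV \<times> cbox a b) (\<lambda>(x, t). g' x t)"
          by (rule continuous_on_subset[OF cg']) simp
      qed auto
      moreover have "integral (cbox a b) (g' x) = blinfun_inner_left (G x)"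
      proof -
        have "g x integrable_on cbox a b"
          unfolding g_def by (intro integrable_continuous continuous_intros)
        from integral_linear[OF this bounded_linear_blinfun_inner_left]
        show ?thesis by (simp add: g'_def o_def flip: intg)
      qed
      ultimately show ?thesis by simp
    qed
    define DG where "DG = - (DV y b - DV y a) - integral (cbox a b) (DA y)"
    have "(G has_derivative blinfun_apply DG) (at y)"
    proof -
      have "((\<lambda>x. integral (cbox a b) (A x)) has_derivative blinfun_apply (integral (cbox a b) (DA y)))
          (at y within UNIV)"
      proof (rule leibniz_rule)
        show "((\<lambda>x. A x t) has_derivative blinfun_apply (DA x t)) (at x within UNIV)" for x t
          using A by simp
        show "A x integrable_on cbox a b" for x
          by (intro integrable_continuous continuous_intros)
        show "continuous_on (UNIV \<times> cbox a b) (\<lambda>(x, t). DA x t)"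
          by (rule continuous_on_subset[OF cDA]) simp
      qed auto
      then show ?thesis unfolding G_def DG_def
        by (auto intro!: derivative_eq_intros V simp: blinfun.bilinear_simps)
    qed
    from bounded_linear.has_derivative[OF bounded_linear_blinfun_inner_left this]
    have "((\<lambda>x. blinfun_inner_left (G x)) has_derivative (\<lambda>h. blinfun_inner_left (DG h))) (at y)" .
    from symmetric_second_derivative[OF Q this, of u v]
    have "DG u \<bullet> v = DG v \<bullet> u" by (simp add: inner_commute)
    moreover have DAi: "DA y integrable_on cbox a b"
      by (intro integrable_continuous continuous_intros)
    have e: "integral (cbox a b) (DA y) h \<bullet> k = integral (cbox a b) (\<lambda>t. DA y t h \<bullet> k)" for h k
    proof -
      have "integral (cbox a b) (DA y) h = integral (cbox a b) (\<lambda>t. DA y t h)"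
        by (rule blinfun_apply_integral[OF DAi])
      moreover have "(\<lambda>t. DA y t h) integrable_on cbox a b"
        by (intro integrable_continuous continuous_intros)
      ultimately show ?thesis
        using integral_linear[OF _ bounded_linear_inner_left, of "\<lambda>t. DA y t h" "cbox a b" k]
        by (simp add: o_def)
    qed
    moreover have "integral (cbox a b) ?c =
       integral (cbox a b) (\<lambda>t. DA y t u \<bullet> v) - integral (cbox a b) (\<lambda>t. DA y t v \<bullet> u)"
      by (intro integral_diff integrable_continuous continuous_intros)
    ultimately show ?thesis
      by (simp add: DG_def blinfun.bilinear_simps inner_diff_left inner_minus_left)
  qed
  \<comment> \<open>Starting the primitive at \<open>s - 1\<close> makes \<open>s\<close> an
    interior time, so that the derivative is two-sided; \<open>main\<close> identifies the primitive
    with \<open>?w\<close> for all later times.\<close>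
  have "((\<lambda>t. ?w (s - 1) - integral {s-1..t} ?c) has_real_derivative - ?c s) (at s within {s-1..s+1})"
  proof -
    have "continuous_on {s-1..s+1} ?c" by (intro continuous_intros)
    from DERIV_diff[OF DERIV_const integral_has_real_derivative[OF this]]
    show ?thesis by simp
  qed
  then have "((\<lambda>t. ?w (s - 1) - integral {s-1..t} ?c) has_real_derivative - ?c s) (at s)"
    by (simp add: at_within_Icc_at)
  moreover have "\<forall>\<^sub>F t in nhds s. ?w (s - 1) - integral {s-1..t} ?c = ?w t"
  proof -
    have "\<forall>\<^sub>F t in nhds s. t > s - 1" using eventually_nhds_in_open[of "{s-1<..}" s] by auto
    then show ?thesis
    proof eventually_elim
      case (elim t)
      then show ?case using main[of "s - 1" t] by linarith
    qed
  qed
  ultimately show ?thesis by (subst (asm) DERIV_cong_ev[OF refl _ refl]) simp_all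
qed

section \<open>The flow in arbitrary dimension and its enstrophy balance\<close>

text \<open>Here \<beta> stands for \<open>\<alpha> / (\<alpha> + 1)\<close> and \<gamma> for
  \<open>1 / (\<alpha> + 1)\<close>. The momentum equation is read as a formula for the derivative
  of the pressure, with both transport terms joined into one application of \<open>DV\<close> to the
  drift.\<close>

locale self_similar_flow =
  fixes V Vs :: "'a::euclidean_space \<Rightarrow> real \<Rightarrow> 'a" and P :: "'a \<Rightarrow> real \<Rightarrow> real"
    and DV :: "'a \<Rightarrow> real \<Rightarrow> 'a \<Rightarrow>\<^sub>L 'a" and D2V :: "'a \<Rightarrow> real \<Rightarrow> 'a \<Rightarrow>\<^sub>L 'a \<Rightarrow>\<^sub>L 'a"
    and \<beta> \<gamma> M :: real
  assumes V: "\<And>y s. ((\<lambda>x. V x s) has_derivative blinfun_apply (DV y s)) (at y)"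
    and Vs: "\<And>y s. ((\<lambda>t. V y t) has_vector_derivative Vs y s) (at s)"
    and DV: "\<And>y s. ((\<lambda>x. DV x s) has_derivative blinfun_apply (D2V y s)) (at y)"
    and P: "\<And>y s. ((\<lambda>x. P x s) has_derivative
      (\<lambda>h. - (Vs y s + (\<beta> *\<^sub>R V y s + DV y s (\<gamma> *\<^sub>R y + V y s))) \<bullet> h)) (at y)"
    and cVs: "continuous_on UNIV (\<lambda>(y, s). Vs y s)"
    and cDV: "continuous_on UNIV (\<lambda>(y, s). DV y s)"
    and cD2V: "continuous_on UNIV (\<lambda>(y, s). D2V y s)"
    and \<beta>\<gamma>: "\<beta> + \<gamma> = 1" and \<gamma>: "\<gamma> > 0"
    and div0: "\<And>y s. (\<Sum>i\<in>Basis. DV y s i \<bullet> i) = 0"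
    and M: "\<And>y s i. i \<in> Basis \<Longrightarrow> norm (DV y s i) \<le> M"
begin

lemma D2V_commute: "D2V y s u v = D2V y s v u"
  using symmetric_second_derivative[OF V DV] .

lemma continuous_on_V: "continuous_on UNIV (\<lambda>(y, s). V y s)"
proof -
  have "continuous_on UNIV (V 0)"
    using Vs by (intro continuous_at_imp_continuous_on)
      (auto intro!: has_vector_derivative_continuous)
  then have "continuous_on UNIV (\<lambda>z::'a \<times> real. V 0 (snd z))"
    by (rule continuous_on_compose2) (auto intro!: continuous_intros)
  from continuous_on_add[OF continuous_on_difference_joint[OF V cDV] this]
  show ?thesis by (simp add: split_beta)
qed

lemmas continuous_fields [continuous_intros] =
  continuous_on_compose2[OF cVs, of _ "\<lambda>x. (f x, g x)" for f g, simplified]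
  continuous_on_compose2[OF cDV, of _ "\<lambda>x. (f x, g x)" for f g, simplified]
  continuous_on_compose2[OF cD2V, of _ "\<lambda>x. (f x, g x)" for f g, simplified]
  continuous_on_compose2[OF continuous_on_V, of _ "\<lambda>x. (f x, g x)" for f g, simplified]

definition drift :: "'a \<Rightarrow> real \<Rightarrow> 'a" where "drift y s = \<gamma> *\<^sub>R y + V y s"

definition vort :: "'a \<Rightarrow> 'a \<Rightarrow> 'a \<Rightarrow> real \<Rightarrow> real" where
  "vort i j y s = DV y s i \<bullet> j - DV y s j \<bullet> i"

definition vort_space :: "'a \<Rightarrow> 'a \<Rightarrow> 'a \<Rightarrow> real \<Rightarrow> 'a \<Rightarrow> real" where
  "vort_space i j y s h = D2V y s h i \<bullet> j - D2V y s h j \<bullet> i"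

text \<open>This is the antisymmetric part of the square of the velocity gradient, produced by
  differentiating the argument \<open>V\<close> of the advection term.\<close>

definition stretching :: "'a \<Rightarrow> 'a \<Rightarrow> 'a \<Rightarrow> real \<Rightarrow> real" where
  "stretching i j y s = DV y s (DV y s i) \<bullet> j - DV y s (DV y s j) \<bullet> i"

text \<open>The coefficient of \<open>vort\<close> is \<beta> + \<gamma> = 1: the damping
  contributes \<beta>, the differentiation of the linear part of the drift contributes
  \<gamma>.\<close>

definition vort_time :: "'a \<Rightarrow> 'a \<Rightarrow> 'a \<Rightarrow> real \<Rightarrow> real" where
  "vort_time i j y s = - (vort i j y s + vort_space i j y s (drift y s) + stretching i j y s)"

text \<open>Squares keep the quantity differentiable where the vorticity vanishes. The sum runs over
  ordered pairs, so in dimension three it is twice the squared length of the curl.\<close>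

definition enstrophy :: "'a \<Rightarrow> real \<Rightarrow> real" where
  "enstrophy y s = (\<Sum>i\<in>Basis. \<Sum>j\<in>Basis. (vort i j y s)\<^sup>2)"

definition enstrophy_space :: "'a \<Rightarrow> real \<Rightarrow> 'a \<Rightarrow> real" where
  "enstrophy_space y s h = (\<Sum>i\<in>Basis. \<Sum>j\<in>Basis. 2 * vort i j y s * vort_space i j y s h)"

definition enstrophy_time :: "'a \<Rightarrow> real \<Rightarrow> real" where
  "enstrophy_time y s = (\<Sum>i\<in>Basis. \<Sum>j\<in>Basis. 2 * vort i j y s * vort_time i j y s)"

text \<open>The 2 comes from the damping; the rest is twice the bound \<open>2 * M * DIM('a)\<close>
  for the stretching relative to the enstrophy.\<close>

definition growth :: real where "growth = 2 + 4 * M * DIM('a)"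

lemma vort_has_derivative_space:
  "((\<lambda>x. vort i j x s) has_derivative vort_space i j y s) (at y)"
  unfolding vort_def vort_space_def
  by (intro has_derivative_diff has_derivative_inner_left
      bounded_linear.has_derivative[OF blinfun.bounded_linear_left DV])

lemma vort_has_derivative_time:
  "((\<lambda>t. vort i j y t) has_real_derivative vort_time i j y s) (at s)"
proof -
  define A where "A = (\<lambda>y s. \<beta> *\<^sub>R V y s + DV y s (drift y s))"
  \<comment> \<open>The symmetry of \<open>D2V\<close> places the drift in the first slot. The
    second-order term is then the derivative of \<open>DV\<close> along the drift, and its
    antisymmetric part is the transport of the vorticity.\<close>
  define DA where "DA = (\<lambda>y s. \<beta> *\<^sub>R DV y s + D2V y s (drift y s)
    + (DV y s o\<^sub>L (\<gamma> *\<^sub>R id_blinfun + DV y s)))"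
  have D: "((\<lambda>x. DV x s (drift x s)) has_derivative
      (\<lambda>h. DV y s (\<gamma> *\<^sub>R h + DV y s h) + D2V y s h (drift y s))) (at y)" for y s
    unfolding drift_def
    by (rule blinfun.FDERIV[OF DV]) (auto intro!: derivative_eq_intros V)
  have A': "((\<lambda>x. A x s) has_derivative blinfun_apply (DA y s)) (at y)" for y s
    unfolding A_def
    by (rule has_derivative_eq_rhs[OF has_derivative_add[OF has_derivative_scaleR_right[OF V] D]])
      (simp add: DA_def blinfun.bilinear_simps D2V_commute[of y s "drift y s"] fun_eq_iff)
  have P': "((\<lambda>x. P x s) has_derivative (\<lambda>h. - (Vs y s + A y s) \<bullet> h)) (at y)" for y s
    using P unfolding A_def drift_def .
  have c: "continuous_on UNIV (\<lambda>(y, s). A y s)" "continuous_on UNIV (\<lambda>(y, s). DA y s)"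
    unfolding A_def DA_def drift_def split_beta
    by (auto intro!: continuous_intros
        bounded_bilinear.continuous_on[OF bounded_bilinear_blinfun_compose])
  have "- (DA y s i \<bullet> j - DA y s j \<bullet> i) = vort_time i j y s"
  proof -
    have \<beta>: "\<beta> = 1 - \<gamma>" using \<beta>\<gamma> by simp
    show ?thesis
      unfolding DA_def \<beta> vort_time_def vort_def vort_space_def stretching_def
      by (simp add: blinfun.bilinear_simps algebra_simps)
  qed
  with antisymmetric_part_time_derivative[OF V A' Vs P' cVs c, of y i j s]
  show ?thesis by (simp add: vort_def)
qed

lemma enstrophy_nonneg: "enstrophy y s \<ge> 0"
  unfolding enstrophy_def by (intro sum_nonneg) auto

lemma enstrophy_has_derivative_space:
  "((\<lambda>x. enstrophy x s) has_derivative enstrophy_space y s) (at y)"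
  unfolding enstrophy_def enstrophy_space_def
  by (auto intro!: derivative_eq_intros vort_has_derivative_space sum.cong)

lemma enstrophy_has_derivative_time:
  "((\<lambda>t. enstrophy y t) has_real_derivative enstrophy_time y s) (at s)"
  unfolding enstrophy_def enstrophy_time_def
  by (auto intro!: derivative_eq_intros vort_has_derivative_time sum.cong)

lemma continuous_on_enstrophy [continuous_intros]:
  fixes f :: "'b::topological_space \<Rightarrow> 'a" and g :: "'b \<Rightarrow> real"
  assumes [continuous_intros]: "continuous_on S f" "continuous_on S g"
  shows "continuous_on S (\<lambda>x. enstrophy (f x) (g x))"
    and "continuous_on S (\<lambda>x. enstrophy_time (f x) (g x))"
  unfolding enstrophy_def enstrophy_time_def vort_time_def vort_def vort_space_def stretching_def
    drift_def
  by (intro continuous_intros)+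

lemma continuous_on_enstrophy_space [continuous_intros]:
  fixes f k :: "'b::topological_space \<Rightarrow> 'a" and g :: "'b \<Rightarrow> real"
  assumes [continuous_intros]: "continuous_on S f" "continuous_on S g" "continuous_on S k"
  shows "continuous_on S (\<lambda>x. enstrophy_space (f x) (g x) (k x))"
  unfolding enstrophy_space_def vort_space_def vort_def by (intro continuous_intros)+

text \<open>In the derivative along the drift the second-order terms cancel. Damping and stretching
  remain, both quadratic in the vorticity once the bound on \<open>DV\<close> is used. A lower bound
  is the useful direction: over a period it limits how much the expansion of volume by the drift can
  be compensated.\<close>

lemma enstrophy_transport: "- (growth * enstrophy y s) \<le> enstrophy_time y s + enstrophy_space y s (drift y s)"
proof -
  let ?B = "Basis :: 'a set"
  let ?W = "\<lambda>i j. vort i j y s"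
  let ?L = "\<lambda>i j. DV y s j \<bullet> i"
  have exp: "DV y s x \<bullet> j = (\<Sum>k\<in>?B. (x \<bullet> k) * (DV y s k \<bullet> j))" for x j
  proof -
    have "DV y s x = DV y s (\<Sum>k\<in>?B. (x \<bullet> k) *\<^sub>R k)" by (simp add: euclidean_representation)
    then show ?thesis by (simp add: blinfun.bilinear_simps blinfun.sum_right inner_sum_left)
  qed
  \<comment> \<open>Adding and subtracting \<open>?L i k * ?L j k\<close> gives each product a
    factor \<open>?W\<close>, so the stretching is linear in the vorticity with coefficients from
    the gradient.\<close>
  have S: "stretching i j y s = (\<Sum>k\<in>?B. ?L i k * ?W k j + ?W i k * ?L j k)" for i j
    unfolding stretching_def exp[of "DV y s i"] exp[of "DV y s j"] sum_subtractf[symmetric]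
    by (intro sum.cong) (auto simp: vort_def algebra_simps)
  have L: "\<bar>?L i j\<bar> \<le> M" if "i \<in> ?B" "j \<in> ?B" for i j
    using Basis_le_norm[OF that(1)] M[OF that(2)] by (rule order_trans)
  have M0: "M \<ge> 0" using L[OF SOME_Basis SOME_Basis] by (rule order_trans[rotated]) simp
  have t: "x * (l * z) \<le> M * ((x\<^sup>2 + z\<^sup>2) / 2)" if "\<bar>l\<bar> \<le> M" for x l z
  proof -
    have "x * (l * z) \<le> \<bar>l\<bar> * (\<bar>x\<bar> * \<bar>z\<bar>)"
      using abs_ge_self[of "x * (l * z)"] by (simp add: abs_mult mult.left_commute)
    also have "\<dots> \<le> M * (\<bar>x\<bar> * \<bar>z\<bar>)" using that by (intro mult_right_mono) auto
    also have "\<dots> \<le> M * ((x\<^sup>2 + z\<^sup>2) / 2)"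
      using M0 sum_squares_bound[of "\<bar>x\<bar>" "\<bar>z\<bar>"] by (intro mult_left_mono) auto
    finally show ?thesis .
  qed
  have "(\<Sum>i\<in>?B. \<Sum>j\<in>?B. ?W i j * stretching i j y s)
      \<le> (\<Sum>i\<in>?B. \<Sum>j\<in>?B. \<Sum>k\<in>?B. M * (((?W i j)\<^sup>2 + (?W k j)\<^sup>2) / 2) + M * (((?W i j)\<^sup>2 + (?W i k)\<^sup>2) / 2))"
    unfolding S sum_distrib_left distrib_left
  proof (intro sum_mono add_mono)
    fix i j k :: 'a assume "i \<in> ?B" "j \<in> ?B" "k \<in> ?B"
    then show "?W i j * (?L i k * ?W k j) \<le> M * (((?W i j)\<^sup>2 + (?W k j)\<^sup>2) / 2)"
      "?W i j * (?W i k * ?L j k) \<le> M * (((?W i j)\<^sup>2 + (?W i k)\<^sup>2) / 2)"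
      using t[OF L] by (simp_all add: mult.commute[of "?W i k"])
  qed
  also have "\<dots> = 2 * M * DIM('a) * enstrophy y s"
  proof -
    have 1: "(\<Sum>i\<in>?B. \<Sum>j\<in>?B. \<Sum>k\<in>?B. (?W i j)\<^sup>2) = DIM('a) * enstrophy y s"
      by (simp add: enstrophy_def sum_distrib_left)
    have 2: "(\<Sum>i\<in>?B. \<Sum>j\<in>?B. \<Sum>k\<in>?B. (?W i k)\<^sup>2) = DIM('a) * enstrophy y s"
      by (simp add: enstrophy_def sum_distrib_left)
    have 3: "(\<Sum>i\<in>?B. \<Sum>j\<in>?B. \<Sum>k\<in>?B. (?W k j)\<^sup>2) = DIM('a) * enstrophy y s"
    proof -
      have "(\<Sum>j\<in>?B. \<Sum>k\<in>?B. (?W k j)\<^sup>2) = enstrophy y s"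
        unfolding enstrophy_def by (rule sum.swap)
      then show ?thesis by simp
    qed
    have "(\<Sum>i\<in>?B. \<Sum>j\<in>?B. \<Sum>k\<in>?B. M * (((?W i j)\<^sup>2 + (?W k j)\<^sup>2) / 2) + M * (((?W i j)\<^sup>2 + (?W i k)\<^sup>2) / 2))
       = M * (\<Sum>i\<in>?B. \<Sum>j\<in>?B. \<Sum>k\<in>?B. (?W i j)\<^sup>2)
        + M / 2 * (\<Sum>i\<in>?B. \<Sum>j\<in>?B. \<Sum>k\<in>?B. (?W i k)\<^sup>2)
        + M / 2 * (\<Sum>i\<in>?B. \<Sum>j\<in>?B. \<Sum>k\<in>?B. (?W k j)\<^sup>2)"
      unfolding sum_distrib_left sum.distrib[symmetric]
      by (intro sum.cong refl) (simp add: field_simps)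
    then show ?thesis unfolding 1 2 3 by simp
  qed
  finally have "(\<Sum>i\<in>?B. \<Sum>j\<in>?B. ?W i j * stretching i j y s) \<le> 2 * M * DIM('a) * enstrophy y s" .
  moreover have "enstrophy_time y s + enstrophy_space y s (drift y s)
     = - 2 * enstrophy y s - 2 * (\<Sum>i\<in>?B. \<Sum>j\<in>?B. ?W i j * stretching i j y s)"
    unfolding enstrophy_time_def enstrophy_space_def enstrophy_def sum_distrib_left
      sum.distrib[symmetric] sum_subtractf[symmetric]
    by (intro sum.cong refl) (simp add: vort_time_def power2_eq_square algebra_simps)
  ultimately show ?thesis by (simp add: growth_def algebra_simps)
qed

end

subsection \<open>Integrating derivatives of compactly supported functions\<close>

lemma integrable_lborel_compact_support:
  fixes f :: "'a::euclidean_space \<Rightarrow> real"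
  assumes "continuous_on UNIV f" and "\<And>x. x \<notin> cball 0 R \<Longrightarrow> f x = 0"
  shows "integrable lborel f"
proof -
  have "integrable lborel (\<lambda>x. indicator (cball 0 R) x *\<^sub>R f x)"
    by (rule borel_integrable_compact) (auto intro: continuous_on_subset[OF assms(1)])
  also have "(\<lambda>x. indicator (cball 0 R) x *\<^sub>R f x) = f"
    using assms(2) by (auto simp: indicator_def fun_eq_iff)
  finally show ?thesis .
qed

text \<open>By translation invariance the difference quotients of \<open>f\<close> integrate to zero; pass to the limit.\<close>

lemma integral_directional_derivative_compact_support:
  fixes f :: "'a::euclidean_space \<Rightarrow> real"
  assumes f: "\<And>x. (f has_derivative f' x) (at x)"
    and c: "continuous_on UNIV (\<lambda>x. f' x e)"
    and supp: "\<And>x. x \<notin> cball 0 R \<Longrightarrow> f x = 0"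
  shows "(LBINT x. f' x e) = 0"
proof -
  define h where "h = (\<lambda>n. 1 / real (Suc n))"
  have h: "0 < h n" "h n \<le> 1" for n by (auto simp: h_def)
  define g where "g = (\<lambda>n x. (f (x + h n *\<^sub>R e) - f x) / h n)"
  have cf: "continuous_on UNIV f"
    using f by (intro continuous_at_imp_continuous_on) (auto intro: has_derivative_continuous)
  have fi: "integrable lborel f" by (rule integrable_lborel_compact_support[OF cf supp])
  have shift: "integrable lborel (\<lambda>x. f (x + c))" "(LBINT x. f (x + c)) = (LBINT x. f x)" for c
  proof -
    have "f \<in> borel_measurable borel" using cf by (rule borel_measurable_continuous_onI)
    then show "integrable lborel (\<lambda>x. f (x + c))" "(LBINT x. f (x + c)) = (LBINT x. f x)"
      using fi integrable_distr_eq[of "(+) c" lborel borel f] integral_distr[of "(+) c" lborel borel f]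
      by (simp_all add: lborel_distr_plus add.commute)
  qed
  \<comment> \<open>A difference quotient can be nonzero only within radius
    \<open>R + norm e\<close>, and the intermediate point of the mean value theorem lies at most
    another \<open>norm e\<close> away.\<close>
  obtain B where B: "\<And>x. x \<in> cball 0 (R + 2 * norm e) \<Longrightarrow> \<bar>f' x e\<bar> \<le> B"
  proof -
    have "bounded ((\<lambda>x. f' x e) ` cball 0 (R + 2 * norm e))"
      by (intro compact_imp_bounded compact_continuous_image continuous_on_subset[OF c]) auto
    then show ?thesis using that unfolding bounded_iff
      by (auto simp del: mem_cball mem_cball_0)
  qed
  have g: "\<exists>t\<in>{0<..<1}. g n x = f' (x + (t * h n) *\<^sub>R e) e" for n x
  proof -
    have D: "((\<lambda>t. f (x + (t * h n) *\<^sub>R e)) has_derivative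
       (\<lambda>k. f' (x + (t * h n) *\<^sub>R e) ((k * h n) *\<^sub>R e))) (at t within {0..1})" for t
      by (rule has_derivative_at_withinI, rule has_derivative_compose[OF _ f])
         (auto intro!: derivative_eq_intros)
    obtain t where "t \<in> {0<..<1}" "f (x + h n *\<^sub>R e) - f x = f' (x + (t * h n) *\<^sub>R e) (h n *\<^sub>R e)"
      using mvt_simple[OF zero_less_one D] by auto
    then show ?thesis
      using h[of n] has_derivative_linear[OF f]
      by (auto simp: g_def linear_cmul intro!: bexI[of _ t])
  qed
  have lim: "(\<lambda>n. LBINT x. g n x) \<longlonglongrightarrow> (LBINT x. f' x e)"
  proof (rule integral_dominated_convergence)
    show "(\<lambda>x. f' x e) \<in> borel_measurable lborel"
      using borel_measurable_continuous_onI[OF c] by simp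
    show "g n \<in> borel_measurable lborel" for n
      unfolding g_def using borel_measurable_continuous_onI[OF cf] shift(1)[of "h n *\<^sub>R e"]
      by (intro borel_measurable_divide borel_measurable_diff) (auto dest: borel_measurable_integrable)
    show "integrable lborel (\<lambda>x::'a. B * indicator (cball 0 (R + norm e)) x)"
      by (intro integrable_mult_right integrable_real_indicator emeasure_bounded_finite[unfolded infinity_ennreal_def])
        (auto intro: emeasure_bounded_finite[unfolded infinity_ennreal_def])
    have "norm (g n x) \<le> B * indicator (cball 0 (R + norm e)) x" for n x
    proof (cases "x \<in> cball 0 (R + norm e)")
      case True
      obtain t where t: "t \<in> {0<..<1}" "g n x = f' (x + (t * h n) *\<^sub>R e) e" using g by blast
      have "t * h n \<le> 1" using t(1) h[of n] by (intro mult_le_one) auto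
      then have "norm ((t * h n) *\<^sub>R e) \<le> norm e"
        using t(1) h[of n] by (simp add: abs_mult mult_left_le_one_le)
      then have "x + (t * h n) *\<^sub>R e \<in> cball 0 (R + 2 * norm e)"
        using True norm_triangle_ineq[of x "(t * h n) *\<^sub>R e"] by simp
      from B[OF this] show ?thesis using True t(2) by simp
    next
      case False
      have "norm (h n *\<^sub>R e) \<le> norm e" using h[of n] by (simp add: mult_left_le_one_le)
      then have "x + h n *\<^sub>R e \<notin> cball 0 R" "x \<notin> cball 0 R"
        using False norm_diff_ineq[of x "h n *\<^sub>R e"] norm_ge_zero[of e]
        unfolding mem_cball_0 by linarith+
      then show ?thesis using False by (simp add: g_def supp)
    qed
    then show "AE x in lborel. norm (g n x) \<le> B * indicator (cball 0 (R + norm e)) x" for n by simp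
    have "(\<lambda>n. g n x) \<longlonglongrightarrow> f' x e" for x
    proof -
      have "\<forall>n. \<exists>t. t \<in> {0<..<1} \<and> g n x = f' (x + (t * h n) *\<^sub>R e) e" using g by blast
      from choice[OF this] obtain t
        where t: "\<And>n. t n \<in> {0<..<1}" "\<And>n. g n x = f' (x + (t n * h n) *\<^sub>R e) e" by blast
      have h0: "h \<longlonglongrightarrow> 0" unfolding h_def using LIMSEQ_inverse_real_of_nat by (simp add: divide_inverse)
      have "(\<lambda>n. t n * h n) \<longlonglongrightarrow> 0"
        by (rule tendsto_sandwich[OF _ _ tendsto_const h0])
           (use t(1) h in \<open>auto simp: less_imp_le mult_left_le_one_le intro!: always_eventually\<close>)
      then have "(\<lambda>n. x + (t n * h n) *\<^sub>R e) \<longlonglongrightarrow> x + 0 *\<^sub>R e"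
        by (intro tendsto_intros)
      then show ?thesis
        unfolding t(2) using c isCont_tendsto_compose[of x "\<lambda>x. f' x e"]
        by (simp add: continuous_on_eq_continuous_at)
    qed
    then show "AE x in lborel. (\<lambda>n. g n x) \<longlonglongrightarrow> f' x e" by simp
  qed
  have "(LBINT x. g n x) = 0" for n
    unfolding g_def using shift[of "h n *\<^sub>R e"] fi by simp
  with lim show ?thesis by (simp add: LIMSEQ_const_iff)
qed

text \<open>The derivative vanishes off the ball as well, so its integral over the whole space is
  its integral over any set that contains the ball. The set will be a box, where integrals can be
  iterated.\<close>

lemma has_integral_directional_derivative_compact_support:
  fixes f :: "'a::euclidean_space \<Rightarrow> real"
  assumes f: "\<And>x. (f has_derivative f' x) (at x)"
    and c: "continuous_on UNIV (\<lambda>x. f' x e)"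
    and supp: "\<And>x. x \<notin> cball 0 R \<Longrightarrow> f x = 0"
    and sub: "cball 0 R \<subseteq> S"
  shows "((\<lambda>x. f' x e) has_integral 0) S"
proof -
  have supp': "f' x e = 0" if "x \<notin> cball 0 R" for x
  proof -
    have "(f has_derivative (\<lambda>_. 0)) (at x)"
      by (rule has_derivative_transform_within_open
          [of "\<lambda>_. 0" "\<lambda>_. 0" x UNIV "- cball 0 R"])
         (use that supp in auto)
    then show ?thesis using has_derivative_unique[OF f] by metis
  qed
  have "integrable lborel (\<lambda>x. f' x e)" by (rule integrable_lborel_compact_support[OF c supp'])
  from has_integral_integral_lborel[OF this]
  have "((\<lambda>x. f' x e) has_integral 0) UNIV"
    using integral_directional_derivative_compact_support[OF f c supp] by simp
  moreover have "(\<lambda>x. if x \<in> S then f' x e else 0) = (\<lambda>x. f' x e)"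
    by (rule ext) (use supp' sub in \<open>auto simp del: mem_cball_0 mem_cball\<close>)
  ultimately show ?thesis using has_integral_restrict_UNIV[of S "\<lambda>x. f' x e" 0] by simp
qed

subsection \<open>The weighted integral inequality\<close>

lemma has_real_derivative_max_0_square:
  "((\<lambda>x::real. (max 0 x)\<^sup>2) has_real_derivative 2 * max 0 x) (at x)"
proof (cases x "0::real" rule: linorder_cases)
  case less
  have "((\<lambda>x::real. 0) has_real_derivative 2 * max 0 x) (at x)" using less by simp
  then show ?thesis
    by (rule has_field_derivative_transform_within_open[of _ _ _ "{..<0}"]) (use less in auto)
next
  case greater
  have "((\<lambda>x::real. x\<^sup>2) has_real_derivative 2 * max 0 x) (at x)"
    using greater by (auto intro!: derivative_eq_intros)
  then show ?thesis
    by (rule has_field_derivative_transform_within_open[of _ _ _ "{0<..}"]) (use greater in auto)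
next
  case equal
  have "((\<lambda>h::real. (max 0 h)\<^sup>2 / h) \<longlongrightarrow> 0) (at 0)"
  proof (rule tendsto_0_le[where K = 1 and f = "\<lambda>h. h", OF tendsto_ident_at], rule always_eventually, rule allI)
    show "norm ((max 0 h)\<^sup>2 / h) \<le> norm h * 1" for h :: real
      by (auto simp: max_def power2_eq_square)
  qed
  then show ?thesis using equal by (simp add: DERIV_def)
qed

text \<open>For \<open>R > 0\<close>, squaring the positive part smooths the corner at the sphere of
  radius \<open>R\<close>, which makes the cutoff continuously differentiable.\<close>

definition bump :: "real \<Rightarrow> 'a::real_inner \<Rightarrow> real" where
  "bump R y = (max 0 (1 - (y \<bullet> y) / R\<^sup>2))\<^sup>2"

definition bump' :: "real \<Rightarrow> 'a::real_inner \<Rightarrow> 'a \<Rightarrow> real" where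
  "bump' R y h = - 4 * max 0 (1 - (y \<bullet> y) / R\<^sup>2) * (y \<bullet> h) / R\<^sup>2"

lemma bump_has_derivative: "(bump R has_derivative bump' R y) (at y)"
proof -
  have "((\<lambda>y. 1 - (y \<bullet> y) / R\<^sup>2) has_derivative (\<lambda>h. - (2 * (y \<bullet> h)) / R\<^sup>2)) (at y)"
    by (auto intro!: derivative_eq_intros simp: inner_commute divide_inverse)
  from has_derivative_compose[OF this has_real_derivative_max_0_square[unfolded has_field_derivative_def]]
  show ?thesis unfolding bump_def[abs_def] bump'_def[abs_def]
    by (rule has_derivative_eq_rhs) (simp add: fun_eq_iff)
qed

lemma continuous_on_bump [continuous_intros]:
  assumes "continuous_on S f"
  shows "continuous_on S (\<lambda>x. bump R (f x))"
  unfolding bump_def using assms by (cases "R = 0") (auto intro!: continuous_intros)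

lemma continuous_on_bump' [continuous_intros]:
  assumes "continuous_on S f" "continuous_on S g"
  shows "continuous_on S (\<lambda>x. bump' R (f x) (g x))"
  unfolding bump'_def using assms by (cases "R = 0") (auto intro!: continuous_intros)

lemma bump_bounds: "0 \<le> bump R y" "bump R y \<le> 1"
  unfolding bump_def by (auto intro!: power_le_one)

lemma bump_eq_0:
  assumes "y \<notin> cball 0 R" "R > 0"
  shows "bump R y = 0" "bump' R y h = 0"
proof -
  have "R\<^sup>2 \<le> y \<bullet> y"
    using assms by (simp add: dot_square_norm power_mono)
  then have "max 0 (1 - (y \<bullet> y) / R\<^sup>2) = 0" using assms by (simp add: field_simps)
  then show "bump R y = 0" "bump' R y h = 0" by (simp_all add: bump_def bump'_def)
qed

lemma bump'_bound:
  assumes "R > 0"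
  shows "\<bar>bump' R y h\<bar> \<le> 4 * norm y * norm h / R\<^sup>2"
proof -
  have "\<bar>bump' R y h\<bar> = 4 * max 0 (1 - (y \<bullet> y) / R\<^sup>2) * \<bar>y \<bullet> h\<bar> / R\<^sup>2"
    by (simp add: bump'_def abs_mult abs_divide)
  also have "\<dots> \<le> 4 * 1 * (norm y * norm h) / R\<^sup>2"
    by (intro divide_right_mono mult_mono) (auto simp: Cauchy_Schwarz_ineq2)
  finally show ?thesis by (simp add: mult.assoc)
qed

lemma bump_tendsto: "(\<lambda>n. bump (real (Suc n)) y) \<longlonglongrightarrow> 1"
proof -
  have "(\<lambda>n. inverse (real (Suc n))) \<longlonglongrightarrow> 0" by (rule LIMSEQ_inverse_real_of_nat)
  then have "(\<lambda>n. (max 0 (1 - (y \<bullet> y) * (inverse (real (Suc n)))\<^sup>2))\<^sup>2) \<longlonglongrightarrow> (max 0 (1 - (y \<bullet> y) * 0\<^sup>2))\<^sup>2"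
    by (intro tendsto_intros)
  then show ?thesis unfolding bump_def by (simp add: divide_inverse power_inverse)
qed

context self_similar_flow
begin

text \<open>Integrate the divergence form of the transport equation for \<open>\<phi> (enstrophy) * \<eta>\<close> over one
  period; the drift has divergence \<open>\<gamma> * DIM('a)\<close>, which is the gain that has to beat \<open>growth\<close>.\<close>

lemma weighted_enstrophy_inequality:
  fixes \<phi> \<phi>' :: "real \<Rightarrow> real" and \<eta> :: "'a \<Rightarrow> real"
  assumes per: "\<And>y. V y T = V y 0" and T: "T \<ge> 0"
    and \<phi>: "\<And>x. x \<ge> 0 \<Longrightarrow> (\<phi> has_real_derivative \<phi>' x) (at x)"
    and c\<phi>': "continuous_on {0..} \<phi>'" and \<phi>'0: "\<And>x. x \<ge> 0 \<Longrightarrow> \<phi>' x \<ge> 0"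
    and \<eta>: "\<And>y. (\<eta> has_derivative \<eta>' y) (at y)"
    and \<eta>0: "\<And>y. \<eta> y \<ge> 0"
    and c\<eta>': "\<And>f. continuous_on UNIV f \<Longrightarrow> continuous_on UNIV (\<lambda>z::'a \<times> real. \<eta>' (fst z) (f z))"
    and supp: "\<And>y. y \<notin> cball 0 R \<Longrightarrow> \<eta> y = 0"
    and box: "cball 0 R \<subseteq> cbox a c"
  shows "\<gamma> * DIM('a) * integral (cbox (a, 0) (c, T)) (\<lambda>(y, s). \<phi> (enstrophy y s) * \<eta> y)
    \<le> integral (cbox (a, 0) (c, T)) (\<lambda>(y, s). growth * (enstrophy y s * \<phi>' (enstrophy y s)) * \<eta> y
         - \<phi> (enstrophy y s) * \<eta>' y (drift y s))"
proof -
  let ?B = "Basis :: 'a set"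
  let ?w = enstrophy
  have c\<phi>: "continuous_on {0..} \<phi>"
    using \<phi> by (intro continuous_at_imp_continuous_on) (auto intro: DERIV_isCont)
  have c\<eta>: "continuous_on UNIV \<eta>"
    using \<eta> by (intro continuous_at_imp_continuous_on) (auto intro: has_derivative_continuous)
  have [continuous_intros]: "continuous_on S (\<lambda>x. \<phi> (?w (f x) (g x)))"
    "continuous_on S (\<lambda>x. \<phi>' (?w (f x) (g x)))"
    if "continuous_on S f" "continuous_on S g" for S :: "('a \<times> real) set" and f g
    using that enstrophy_nonneg
    by (auto intro!: continuous_intros continuous_on_compose2[OF c\<phi>] continuous_on_compose2[OF c\<phi>'])
  have [continuous_intros]: "continuous_on S (\<lambda>x. \<eta> (f x))" if "continuous_on S f"
    for S :: "('a \<times> real) set" and f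
    by (rule continuous_on_compose2[OF c\<eta> that]) auto
  \<comment> \<open>\<open>Ft\<close> and \<open>Fx\<close> are the time and space derivatives of
    the weighted density, and \<open>Gx i\<close> is the space derivative of the \<open>i\<close>-th
    component of its flux along the drift; the divergence of the flux is the sum of
    \<open>Gx i y s i\<close>.\<close>
  define Ft where "Ft = (\<lambda>y s. \<phi>' (?w y s) * enstrophy_time y s * \<eta> y)"
  define Fx where "Fx = (\<lambda>y s h. \<phi>' (?w y s) * enstrophy_space y s h * \<eta> y + \<phi> (?w y s) * \<eta>' y h)"
  define Gx where "Gx = (\<lambda>i y s h. (drift y s \<bullet> i) * Fx y s h
     + ((\<gamma> *\<^sub>R h + DV y s h) \<bullet> i) * (\<phi> (?w y s) * \<eta> y))"
  have Ft: "((\<lambda>t. \<phi> (?w y t) * \<eta> y) has_real_derivative Ft y s) (at s)" for y s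
    unfolding Ft_def
    by (rule DERIV_cmult_right[OF DERIV_chain2[OF \<phi>[OF enstrophy_nonneg] enstrophy_has_derivative_time]])
  have Fx: "((\<lambda>x. \<phi> (?w x s) * \<eta> x) has_derivative Fx y s) (at y)" for y s
  proof -
    have "((\<lambda>x. \<phi> (?w x s)) has_derivative (\<lambda>h. \<phi>' (?w y s) * enstrophy_space y s h)) (at y)"
      using has_derivative_compose[OF enstrophy_has_derivative_space \<phi>[OF enstrophy_nonneg, unfolded has_field_derivative_def]] .
    from has_derivative_mult[OF this \<eta>] show ?thesis
      by (rule has_derivative_eq_rhs) (auto simp: Fx_def fun_eq_iff)
  qed
  have Gx: "((\<lambda>x. (drift x s \<bullet> i) * (\<phi> (?w x s) * \<eta> x)) has_derivative Gx i y s) (at y)" for i y s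
  proof -
    have "((\<lambda>x. drift x s \<bullet> i) has_derivative (\<lambda>h. (\<gamma> *\<^sub>R h + DV y s h) \<bullet> i)) (at y)"
      unfolding drift_def
      by (intro has_derivative_inner_left has_derivative_add V has_derivative_scaleR_right has_derivative_ident)
    from has_derivative_mult[OF this Fx] show ?thesis
      by (rule has_derivative_eq_rhs) (auto simp: Gx_def fun_eq_iff)
  qed
  have lin: "bounded_linear (Fx y s)" for y s using Fx by (rule has_derivative_bounded_linear)
  have Gsum: "(\<Sum>i\<in>?B. Gx i y s i) = Fx y s (drift y s) + \<gamma> * DIM('a) * (\<phi> (?w y s) * \<eta> y)" for y s
  proof -
    have "Fx y s (drift y s) = Fx y s (\<Sum>i\<in>?B. (drift y s \<bullet> i) *\<^sub>R i)"
      by (simp add: euclidean_representation)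
    also have "\<dots> = (\<Sum>i\<in>?B. (drift y s \<bullet> i) * Fx y s i)"
      using bounded_linear.linear[OF lin] by (simp add: linear_sum linear_cmul)
    finally have 1: "(\<Sum>i\<in>?B. (drift y s \<bullet> i) * Fx y s i) = Fx y s (drift y s)" by simp
    have "(\<Sum>i\<in>?B. (\<gamma> *\<^sub>R i + DV y s i) \<bullet> i) = (\<Sum>i\<in>?B. \<gamma>) + (\<Sum>i\<in>?B. DV y s i \<bullet> i)"
      unfolding sum.distrib[symmetric] by (intro sum.cong) (auto simp: inner_add_left)
    then have 2: "(\<Sum>i\<in>?B. (\<gamma> *\<^sub>R i + DV y s i) \<bullet> i) = \<gamma> * DIM('a)" using div0 by simp
    show ?thesis unfolding Gx_def sum.distrib 1 sum_distrib_right[symmetric] 2 by simp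
  qed
  have cd [continuous_intros]: "continuous_on UNIV (\<lambda>z::'a \<times> real. drift (fst z) (snd z))"
    unfolding drift_def by (intro continuous_intros)
  have cdS [continuous_intros]: "continuous_on S (\<lambda>z::'a \<times> real. drift (fst z) (snd z))" for S
    by (rule continuous_on_subset[OF cd]) auto
  have c\<eta>d [continuous_intros]: "continuous_on S (\<lambda>z::'a \<times> real. \<eta>' (fst z) (drift (fst z) (snd z)))" for S
    by (rule continuous_on_subset[OF c\<eta>'[OF cd]]) auto
  have c\<eta>c [continuous_intros]: "continuous_on S (\<lambda>z::'a \<times> real. \<eta>' (fst z) h)" for S h
    by (rule continuous_on_subset[OF c\<eta>'[OF continuous_on_const]]) auto
  have cFt: "continuous_on S (\<lambda>(y, s). Ft y s)" for S
    unfolding Ft_def case_prod_unfold by (intro continuous_intros)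
  have cGx: "continuous_on S (\<lambda>(y, s). Gx i y s h)" for i h S
    unfolding Gx_def Fx_def case_prod_unfold by (intro continuous_intros)
  have It: "integral (cbox (a, 0) (c, T)) (\<lambda>(y, s). Ft y s) = 0"
  proof -
    have "?w y T = ?w y 0" for y
    proof -
      have "DV y T = DV y 0"
        using V[of T y] V[of 0 y] per by (auto intro!: blinfun_eqI dest: has_derivative_unique)
      then show ?thesis by (simp add: enstrophy_def vort_def)
    qed
    then have ft: "(Ft y has_integral 0) (cbox 0 T)" for y
      using fundamental_theorem_of_calculus[OF T, of "\<lambda>t. \<phi> (?w y t) * \<eta> y" "Ft y"] Ft
      by (simp add: has_real_derivative_iff_has_vector_derivative has_vector_derivative_at_within)
    show ?thesis
      using integral_prod_continuous[OF cFt, of a 0 c T] integral_unique[OF ft] by simp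
  qed
  have Ix: "integral (cbox (a, 0) (c, T)) (\<lambda>(y, s). Gx i y s i) = 0" for i
  proof -
    have gx: "((\<lambda>y. Gx i y s i) has_integral 0) (cbox a c)" for s
    proof (rule has_integral_directional_derivative_compact_support[OF Gx _ _ box])
      show "continuous_on UNIV (\<lambda>y. Gx i y s i)"
      proof -
        have "continuous_on UNIV (\<lambda>y::'a. (y, s))" by (intro continuous_intros)
        from continuous_on_compose2[OF cGx[of UNIV i i] this] show ?thesis by simp
      qed
    qed (simp add: supp)
    show ?thesis
      using integral_prod_continuous[OF cGx, of a 0 c T i i]
        integral_swap_continuous[OF cGx, of a c 0 T i i] integral_unique[OF gx] by simp
  qed
  let ?Z = "cbox (a, 0) (c, T)"
  have zero: "integral ?Z (\<lambda>(y, s). Ft y s + (\<Sum>i\<in>?B. Gx i y s i)) = 0"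
  proof -
    have 1: "((\<lambda>(y, s). Ft y s) has_integral 0) ?Z"
      by (rule has_integral_eq_rhs[OF integrable_integral[OF integrable_continuous[OF cFt]]]) (simp add: It)
    have 2: "((\<lambda>(y, s). Gx i y s i) has_integral 0) ?Z" for i
      by (rule has_integral_eq_rhs[OF integrable_integral[OF integrable_continuous[OF cGx]]]) (simp add: Ix)
    have "((\<lambda>z. (case z of (y, s) \<Rightarrow> Ft y s) + (\<Sum>i\<in>?B. case z of (y, s) \<Rightarrow> Gx i y s i))
        has_integral (0 + (\<Sum>i\<in>?B. 0))) ?Z"
      by (intro has_integral_add has_integral_sum 1 2) simp
    then show ?thesis by (simp add: case_prod_unfold integral_unique)
  qed
  have "integral ?Z (\<lambda>(y, s). \<gamma> * DIM('a) * (\<phi> (?w y s) * \<eta> y)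
       - (growth * (?w y s * \<phi>' (?w y s)) * \<eta> y - \<phi> (?w y s) * \<eta>' y (drift y s)))
     \<le> integral ?Z (\<lambda>(y, s). Ft y s + (\<Sum>i\<in>?B. Gx i y s i))"
  proof (rule integral_le)
    show "(\<lambda>(y, s). \<gamma> * DIM('a) * (\<phi> (?w y s) * \<eta> y)
       - (growth * (?w y s * \<phi>' (?w y s)) * \<eta> y - \<phi> (?w y s) * \<eta>' y (drift y s))) integrable_on ?Z"
      unfolding case_prod_unfold by (intro integrable_continuous continuous_intros)
    show "(\<lambda>(y, s). Ft y s + (\<Sum>i\<in>?B. Gx i y s i)) integrable_on ?Z"
      using integrable_continuous[OF continuous_on_add[OF cFt continuous_on_sum[OF cGx]]]
      by (auto simp: case_prod_unfold)
    fix z assume "z \<in> ?Z"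
    obtain y s where z: "z = (y, s)" by (cases z)
    \<comment> \<open>This product is exactly the difference of the two integrands: the terms with
      \<gamma> and with the derivative of \<eta> cancel.\<close>
    have "0 \<le> \<phi>' (?w y s) * \<eta> y * (enstrophy_time y s + enstrophy_space y s (drift y s) + growth * ?w y s)"
      using enstrophy_transport[of y s] \<phi>'0[OF enstrophy_nonneg] \<eta>0 by (intro mult_nonneg_nonneg) auto
    then show "(case z of (y, s) \<Rightarrow> \<gamma> * DIM('a) * (\<phi> (?w y s) * \<eta> y)
       - (growth * (?w y s * \<phi>' (?w y s)) * \<eta> y - \<phi> (?w y s) * \<eta>' y (drift y s)))
       \<le> (case z of (y, s) \<Rightarrow> Ft y s + (\<Sum>i\<in>?B. Gx i y s i))"
      unfolding z Gsum by (simp add: Ft_def Fx_def algebra_simps)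
  qed
  moreover have "integral ?Z (\<lambda>(y, s). \<gamma> * DIM('a) * (\<phi> (?w y s) * \<eta> y)
       - (growth * (?w y s * \<phi>' (?w y s)) * \<eta> y - \<phi> (?w y s) * \<eta>' y (drift y s)))
     = \<gamma> * DIM('a) * integral ?Z (\<lambda>(y, s). \<phi> (?w y s) * \<eta> y)
      - integral ?Z (\<lambda>(y, s). growth * (?w y s * \<phi>' (?w y s)) * \<eta> y - \<phi> (?w y s) * \<eta>' y (drift y s))"
    unfolding case_prod_unfold
    by (subst integral_diff) (auto intro!: integrable_continuous continuous_intros)
  ultimately show ?thesis using zero by linarith
qed

end

subsection \<open>Vanishing of the vorticity\<close>

text \<open>All three bounds are uniform in \<open>e\<close>. The second is the subadditivity of a
  concave power, obtained from \<open>t \<le> t powr p\<close> for two fractions that add up to 1;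
  the third holds because the exponent \<open>p - 1\<close> is not positive.\<close>

lemma powr_shift_bounds:
  fixes x e p :: real
  assumes x: "x \<ge> 0" and e: "e > 0" and p: "0 < p" "p \<le> 1"
  shows "0 \<le> (x + e) powr p - e powr p" "(x + e) powr p - e powr p \<le> x powr p"
    "x * (p * (x + e) powr (p - 1)) \<le> p * x powr p"
proof -
  show "0 \<le> (x + e) powr p - e powr p" using assms by (simp add: powr_mono2)
  have ge: "t \<le> t powr p" if "0 \<le> t" "t \<le> 1" for t :: real
    using powr_mono'[of p 1 t] that p by (cases "t = 0") auto
  have "1 = x / (x + e) + e / (x + e)" using x e by (simp flip: add_divide_distrib)
  also have "\<dots> \<le> (x / (x + e)) powr p + (e / (x + e)) powr p"
    using x e by (intro add_mono ge) auto
  also have "\<dots> = (x powr p + e powr p) / (x + e) powr p"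
    using x e by (simp add: powr_divide add_divide_distrib)
  finally show "(x + e) powr p - e powr p \<le> x powr p" using x e by (simp add: field_simps)
  show "x * (p * (x + e) powr (p - 1)) \<le> p * x powr p"
  proof (cases "x = 0")
    case False
    then have "x > 0" using x by simp
    then have "(x + e) powr (p - 1) \<le> x powr (p - 1)" using e p by (intro powr_mono2') auto
    then have "p * (x * (x + e) powr (p - 1)) \<le> p * (x * x powr (p - 1))"
      using x p by (intro mult_left_mono) auto
    also have "x * x powr (p - 1) = x powr p" using \<open>x > 0\<close> by (simp add: powr_mult_base)
    finally show ?thesis by (simp add: mult_ac)
  qed simp
qed

context self_similar_flow
begin

text \<open>Bounded first derivatives make \<open>V\<close> Lipschitz in space, uniformly in time,
  and \<open>V 0\<close> is bounded on the compact time interval.\<close>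

lemma drift_linear_bound:
  assumes "T \<ge> 0"
  shows "\<exists>C\<ge>0. \<forall>y. \<forall>s\<in>{0..T}. norm (drift y s) \<le> C * (1 + norm y)"
proof -
  have M0: "M \<ge> 0" using M[OF SOME_Basis] norm_ge_zero order_trans by blast
  have on: "onorm (DV y s) \<le> real DIM('a) * M" for y s
  proof (rule onorm_le)
    fix x
    have "DV y s x = DV y s (\<Sum>k\<in>Basis. (x \<bullet> k) *\<^sub>R k)" by (simp add: euclidean_representation)
    also have "\<dots> = (\<Sum>k\<in>Basis. (x \<bullet> k) *\<^sub>R DV y s k)"
      by (simp add: blinfun.bilinear_simps blinfun.sum_right)
    also have "norm \<dots> \<le> (\<Sum>k\<in>(Basis::'a set). norm x * M)"
      by (rule sum_norm_le) (auto intro!: mult_mono M Basis_le_norm)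
    finally show "norm (DV y s x) \<le> real DIM('a) * M * norm x" by (simp add: mult_ac)
  qed
  have lip: "norm (V y s - V 0 s) \<le> real DIM('a) * M * norm (y - 0)" for y s
    by (rule differentiable_bound[of UNIV _ "\<lambda>y. blinfun_apply (DV y s)"]) (auto simp: on V)
  have "continuous_on {0..T} (\<lambda>s. V 0 s)" by (intro continuous_intros)
  then have "bounded ((\<lambda>s. V 0 s) ` {0..T})"
    by (intro compact_imp_bounded compact_continuous_image) auto
  then obtain B where B: "\<And>s. s \<in> {0..T} \<Longrightarrow> norm (V 0 s) \<le> B"
    unfolding bounded_iff by (auto simp del: atLeastAtMost_iff)
  have "B \<ge> 0" using B[of 0] assms norm_ge_zero[of "V 0 0"] by (simp del: norm_ge_zero)
  define C where "C = \<gamma> + real DIM('a) * M + B"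
  have "norm (drift y s) \<le> C * (1 + norm y)" if "s \<in> {0..T}" for y s
  proof -
    have "norm (drift y s) \<le> \<gamma> * norm y + (real DIM('a) * M * norm y + B)"
    proof -
      have "norm (V y s) \<le> real DIM('a) * M * norm y + B"
        using lip[of y s] B[OF that] norm_triangle_sub[of "V y s" "V 0 s"] by simp
      then show ?thesis
        unfolding drift_def using norm_triangle_ineq[of "\<gamma> *\<^sub>R y" "V y s"] \<gamma> by simp
    qed
    also have "\<dots> \<le> C * (1 + norm y)"
    proof -
      have "0 \<le> \<gamma> + real DIM('a) * M + B * norm y" using \<gamma> M0 \<open>B \<ge> 0\<close> by (intro add_nonneg_nonneg) auto
      then show ?thesis by (simp add: C_def algebra_simps)
    qed
    finally show ?thesis .
  qed
  moreover have "C \<ge> 0" using \<gamma> M0 \<open>B \<ge> 0\<close> by (simp add: C_def)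
  ultimately show ?thesis by blast
qed

text \<open>The shift \<open>e n\<close> tends to 0 while the cutoff radius \<open>Suc n\<close>
  tends to infinity. A multiple of the integrable function \<open>u\<close> dominates all terms, and
  the limit inequality says that a positive number times the integral of \<open>u\<close> is at most
  0.\<close>

lemma enstrophy_eq_0:
  assumes per: "\<And>y. V y T = V y 0" and T: "T > 0"
    and p: "0 < p" "p \<le> 1" and small: "growth * p < \<gamma> * DIM('a)"
    and int: "integrable (lebesgue_on (UNIV \<times> {0..T})) (\<lambda>(y, s). enstrophy y s powr p)"
    and s: "s \<in> {0..T}"
  shows "enstrophy y s = 0"
proof -
  define Z where "Z = (UNIV :: 'a set) \<times> {0..T}"
  have Z: "Z \<in> sets lebesgue"
  proof -
    have "closed Z" unfolding Z_def by (intro closed_Times) auto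
    then show ?thesis by (intro sets_completionI_sets) (simp add: borel_closed)
  qed
  define w where "w = (\<lambda>z::'a \<times> real. enstrophy (fst z) (snd z))"
  define u where "u = (\<lambda>z. w z powr p)"
  have w0: "w z \<ge> 0" for z by (simp add: w_def enstrophy_nonneg)
  have cw [continuous_intros]: "continuous_on S w" for S
    unfolding w_def by (intro continuous_intros)
  have cu [continuous_intros]: "continuous_on S u" for S
    unfolding u_def by (intro continuous_on_powr' cw continuous_on_const) (use w0 p in auto)
  have u0: "u z \<ge> 0" for z by (simp add: u_def)
  have iu: "integrable (lebesgue_on Z) u"
    using int by (simp add: Z_def u_def w_def case_prod_unfold)
  obtain C where C: "C \<ge> 0" "\<And>y s. s \<in> {0..T} \<Longrightarrow> norm (drift y s) \<le> C * (1 + norm y)"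
    using drift_linear_bound[of T] T by fastforce
  have M0: "M \<ge> 0" using M[OF SOME_Basis] norm_ge_zero order_trans by blast
  have growth0: "growth \<ge> 0" using M0 by (simp add: growth_def)
  have c0: "\<gamma> * DIM('a) > 0" using \<gamma> by simp
  define e where "e = (\<lambda>n. 1 / real (Suc n))"
  have e: "e n > 0" for n by (simp add: e_def)
  define \<phi> where "\<phi> = (\<lambda>n x. (x + e n) powr p - e n powr p)"
  define \<phi>' where "\<phi>' = (\<lambda>n x. p * (x + e n) powr (p - 1))"
  define b where "b = (\<lambda>n (z :: 'a \<times> real). bump (real (Suc n)) (fst z))"
  define b' where "b' = (\<lambda>n z. bump' (real (Suc n)) (fst z) (drift (fst z) (snd z)))"
  \<comment> \<open>On the losing side \<phi> and its derivative are already replaced by their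
    bounds in terms of \<open>u\<close>. The absolute value of \<open>b'\<close> is what permits the
    larger \<open>u\<close> in front of it, whatever the sign of \<open>b'\<close>.\<close>
  define f where "f = (\<lambda>n z. \<gamma> * DIM('a) * (\<phi> n (w z) * b n z) - growth * (p * u z) * b n z - u z * \<bar>b' n z\<bar>)"
  have \<phi>: "0 \<le> \<phi> n (w z)" "\<phi> n (w z) \<le> u z" "w z * \<phi>' n (w z) \<le> p * u z" for n z
    using powr_shift_bounds[OF w0 e p, of z n] by (auto simp: \<phi>_def \<phi>'_def u_def)
  have b01: "0 \<le> b n z" "b n z \<le> 1" for n z by (auto simp: b_def bump_bounds)
  have b'bd: "\<bar>b' n z\<bar> \<le> (4 * norm (fst z) * (C * (1 + norm (fst z)))) * (e n)\<^sup>2" if "z \<in> Z" for n z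
  proof -
    have "\<bar>b' n z\<bar> \<le> 4 * norm (fst z) * norm (drift (fst z) (snd z)) / (real (Suc n))\<^sup>2"
      unfolding b'_def by (rule bump'_bound) simp
    also have "\<dots> \<le> 4 * norm (fst z) * (C * (1 + norm (fst z))) / (real (Suc n))\<^sup>2"
      using that C by (intro divide_right_mono mult_left_mono) (auto simp: Z_def)
    finally show ?thesis by (simp add: e_def power_divide)
  qed
  \<comment> \<open>Inside the ball both \<open>norm (fst z) * e n\<close> and \<open>e n\<close>
    are at most 1, so the factor \<open>(e n)\<^sup>2\<close> absorbs the quadratic growth and
    leaves \<open>4 * C * 2\<close>. Outside, the gradient of the cutoff is zero.\<close>
  have b'C: "\<bar>b' n z\<bar> \<le> 8 * C" if z: "z \<in> Z" for n z
  proof (cases "fst z \<in> cball 0 (real (Suc n))")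
    case True
    then have r: "norm (fst z) * e n \<le> 1" "e n \<le> 1" by (auto simp: e_def field_simps)
    have "4 * norm (fst z) * (C * (1 + norm (fst z))) * (e n)\<^sup>2
        = 4 * C * ((norm (fst z) * e n) * (e n + norm (fst z) * e n))"
      by (simp add: power2_eq_square algebra_simps)
    also have "\<dots> \<le> 4 * C * (1 * (1 + 1))"
      using r C(1) e[of n] by (intro mult_left_mono mult_mono add_mono) auto
    finally show ?thesis by (rule order_trans[OF order_trans[OF b'bd[OF z, of n]]]) simp
  next
    case False
    then show ?thesis using C(1) bump_eq_0(2)[of "fst z" "real (Suc n)"] by (simp add: b'_def)
  qed
  have [continuous_intros]: "continuous_on S (\<lambda>z. \<phi> n (w z))" "continuous_on S (\<lambda>z. \<phi>' n (w z))" for n S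
  proof -
    have "w z + e n \<noteq> 0" for z using w0[of z] e[of n] by linarith
    then show "continuous_on S (\<lambda>z. \<phi> n (w z))" "continuous_on S (\<lambda>z. \<phi>' n (w z))"
      unfolding \<phi>_def \<phi>'_def by (auto intro!: continuous_intros)
  qed
  have [continuous_intros]: "continuous_on S (b n)" "continuous_on S (b' n)" for S n
    unfolding b_def b'_def drift_def by (intro continuous_intros)+
  have cf: "continuous_on S (f n)" for S n
    unfolding f_def by (intro continuous_intros)
  have neg: "integral Z (f n) \<le> 0" for n
  proof -
    let ?R = "real (Suc n)"
    obtain a :: 'a where a: "cball 0 ?R \<subseteq> cbox (- a) a"
      using bounded_subset_cbox_symmetric[OF bounded_cball] .
    let ?B = "cbox (- a, 0) (a, T)"
    have le: "\<gamma> * DIM('a) * integral ?B (\<lambda>(y, s). \<phi> n (enstrophy y s) * bump ?R y)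
      \<le> integral ?B (\<lambda>(y, s). growth * (enstrophy y s * \<phi>' n (enstrophy y s)) * bump ?R y
           - \<phi> n (enstrophy y s) * bump' ?R y (drift y s))"
    proof (rule weighted_enstrophy_inequality[OF per _ _ _ _ bump_has_derivative _ _ _ a])
      show "(\<phi> n has_real_derivative \<phi>' n x) (at x)" if "x \<ge> 0" for x
        unfolding \<phi>_def \<phi>'_def using that e[of n]
        by (auto intro!: derivative_eq_intros)
      show "continuous_on {0..} (\<phi>' n)"
        unfolding \<phi>'_def using e[of n] by (auto intro!: continuous_intros)
      show "0 \<le> \<phi>' n x" for x using p by (simp add: \<phi>'_def)
      show "continuous_on UNIV (\<lambda>z::'a \<times> real. bump' ?R (fst z) (k z))" if "continuous_on UNIV k" for k
        using that by (intro continuous_intros)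
    qed (use T bump_bounds bump_eq_0(1)[of _ ?R] in auto)
    have "integral ?B (f n) = \<gamma> * DIM('a) * integral ?B (\<lambda>z. \<phi> n (w z) * b n z)
        - integral ?B (\<lambda>z. growth * (p * u z) * b n z + u z * \<bar>b' n z\<bar>)"
      unfolding f_def diff_diff_eq
      by (subst integral_diff) (auto intro!: integrable_continuous continuous_intros)
    also have "\<dots> \<le> integral ?B (\<lambda>z. growth * (w z * \<phi>' n (w z)) * b n z - \<phi> n (w z) * b' n z)
        - integral ?B (\<lambda>z. growth * (p * u z) * b n z + u z * \<bar>b' n z\<bar>)"
      using le by (simp add: w_def b_def b'_def case_prod_unfold)
    also have "\<dots> \<le> 0"
    proof -
      have "integral ?B (\<lambda>z. growth * (w z * \<phi>' n (w z)) * b n z - \<phi> n (w z) * b' n z)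
         \<le> integral ?B (\<lambda>z. growth * (p * u z) * b n z + u z * \<bar>b' n z\<bar>)"
      proof (intro integral_le integrable_continuous continuous_intros)
        fix z
        have "growth * (w z * \<phi>' n (w z)) * b n z \<le> growth * (p * u z) * b n z"
          using \<phi> b01 growth0 by (intro mult_right_mono mult_left_mono) auto
        moreover have "- (\<phi> n (w z) * b' n z) \<le> u z * \<bar>b' n z\<bar>"
        proof -
          have "- (\<phi> n (w z) * b' n z) \<le> \<phi> n (w z) * \<bar>b' n z\<bar>"
            using \<phi>(1)[of n z] abs_ge_minus_self[of "\<phi> n (w z) * b' n z"] by (simp add: abs_mult)
          also have "\<dots> \<le> u z * \<bar>b' n z\<bar>" using \<phi> by (intro mult_right_mono) auto
          finally show ?thesis .
        qed
        ultimately show "growth * (w z * \<phi>' n (w z)) * b n z - \<phi> n (w z) * b' n z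
           \<le> growth * (p * u z) * b n z + u z * \<bar>b' n z\<bar>" by simp
      qed
      then show ?thesis by simp
    qed
    finally have neg: "integral ?B (f n) \<le> 0" .
    have "(f n has_integral integral ?B (f n)) ?B"
      by (intro integrable_integral integrable_continuous cf)
    then have "((\<lambda>z. if z \<in> Z then f n z else 0) has_integral integral ?B (f n)) ?B"
      by (rule has_integral_eq[rotated]) (auto simp: Z_def cbox_Pair_eq)
    then have "((\<lambda>z. if z \<in> Z then f n z else 0) has_integral integral ?B (f n)) Z"
    proof (rule has_integral_on_superset)
      fix z assume z: "z \<notin> ?B"
      show "(if z \<in> Z then f n z else 0) = 0"
      proof (cases "z \<in> Z")
        case True
        with z have "fst z \<notin> cbox (- a) a" by (cases z) (auto simp: Z_def cbox_Pair_eq)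
        with a have "fst z \<notin> cball 0 ?R" by blast
        from bump_eq_0[OF this] show ?thesis by (simp add: f_def b_def b'_def)
      qed simp
    qed (auto simp: Z_def cbox_Pair_eq)
    then have "(f n has_integral integral ?B (f n)) Z"
      by (rule has_integral_eq[rotated]) auto
    with neg show ?thesis by (simp add: integral_unique)
  qed
  let ?D = "\<gamma> * DIM('a) + growth * p + 8 * C"
  have meas: "g \<in> borel_measurable (lebesgue_on Z)" if "continuous_on UNIV g" for g :: "_ \<Rightarrow> real"
    by (rule continuous_imp_measurable_on_sets_lebesgue[OF continuous_on_subset[OF that] Z]) auto
  have bd: "norm (f n z) \<le> ?D * u z" if "z \<in> Z" for n z
  proof -
    have "0 \<le> \<phi> n (w z) * b n z" "\<phi> n (w z) * b n z \<le> u z * 1"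
      by (intro mult_nonneg_nonneg mult_mono \<phi> b01 u0)+
    from mult_nonneg_nonneg[OF less_imp_le[OF c0] this(1)] mult_left_mono[OF this(2) less_imp_le[OF c0]]
    have "\<bar>\<gamma> * DIM('a) * (\<phi> n (w z) * b n z)\<bar> \<le> \<gamma> * DIM('a) * (u z * 1)"
      by linarith
    moreover have "\<bar>growth * (p * u z) * b n z\<bar> \<le> growth * (p * u z) * 1"
    proof -
      have "0 \<le> growth * (p * u z)" using growth0 p u0[of z] by simp
      from mult_nonneg_nonneg[OF this b01(1)[of n z]] mult_left_mono[OF b01(2)[of n z] this]
      show ?thesis by linarith
    qed
    moreover have "\<bar>u z * \<bar>b' n z\<bar>\<bar> \<le> u z * (8 * C)"
      using b'C[OF that, of n] u0[of z] by (simp add: abs_mult mult_left_mono)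
    ultimately show ?thesis unfolding f_def real_norm_def by (simp add: algebra_simps)
  qed
  have iD: "integrable (lebesgue_on Z) (\<lambda>z. ?D * u z)" using iu by simp
  have if': "integrable (lebesgue_on Z) (f n)" for n
    by (rule Bochner_Integration.integrable_bound[OF iD meas[OF cf]])
      (use bd[of _ n] in \<open>auto intro!: AE_I2 simp: space_restrict_space intro: order_trans[OF _ abs_ge_self]\<close>)
  have e0: "e \<longlonglongrightarrow> 0" unfolding e_def using LIMSEQ_inverse_real_of_nat by (simp add: divide_inverse)
  have "(\<lambda>n. integral\<^sup>L (lebesgue_on Z) (f n)) \<longlonglongrightarrow>
      (\<integral>z. (\<gamma> * DIM('a) - growth * p) * u z \<partial>lebesgue_on Z)"
  proof (rule integral_dominated_convergence[OF _ _ iD])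
    show "(\<lambda>z. (\<gamma> * DIM('a) - growth * p) * u z) \<in> borel_measurable (lebesgue_on Z)"
      by (intro meas continuous_intros)
    show "f n \<in> borel_measurable (lebesgue_on Z)" for n by (rule meas[OF cf])
    show "AE z in lebesgue_on Z. norm (f n z) \<le> ?D * u z" for n
      using bd by (auto intro!: AE_I2 simp: space_restrict_space)
    have "(\<lambda>n. f n z) \<longlonglongrightarrow> (\<gamma> * DIM('a) - growth * p) * u z" if z: "z \<in> Z" for z
    proof -
      have "(\<lambda>n. \<phi> n (w z)) \<longlonglongrightarrow> (w z + 0) powr p - 0 powr p"
        unfolding \<phi>_def using p w0[of z] e
        by (intro tendsto_diff tendsto_powr' tendsto_add tendsto_const e0)
          (auto intro!: always_eventually add_nonneg_nonneg less_imp_le[OF e])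
      then have 1: "(\<lambda>n. \<phi> n (w z)) \<longlonglongrightarrow> u z" by (simp add: u_def)
      have 2: "(\<lambda>n. b n z) \<longlonglongrightarrow> 1" unfolding b_def by (rule bump_tendsto)
      have 3: "(\<lambda>n. \<bar>b' n z\<bar>) \<longlonglongrightarrow> 0"
      proof (rule tendsto_sandwich[OF _ _ tendsto_const])
        show "(\<lambda>n. (4 * norm (fst z) * (C * (1 + norm (fst z)))) * (e n)\<^sup>2) \<longlonglongrightarrow> 0"
          using tendsto_mult_left[OF tendsto_power[OF e0, of 2]] by fastforce
      qed (use b'bd[OF z] in auto)
      have "(\<lambda>n. f n z) \<longlonglongrightarrow> \<gamma> * DIM('a) * (u z * 1) - growth * (p * u z) * 1 - u z * 0"
        unfolding f_def by (intro tendsto_intros 1 2 3)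
      then show ?thesis by (simp add: algebra_simps)
    qed
    then show "AE z in lebesgue_on Z. (\<lambda>n. f n z) \<longlonglongrightarrow> (\<gamma> * DIM('a) - growth * p) * u z"
      by (auto intro!: AE_I2 simp: space_restrict_space)
  qed
  then have "(\<integral>z. (\<gamma> * DIM('a) - growth * p) * u z \<partial>lebesgue_on Z) \<le> 0"
    by (rule LIMSEQ_le_const2) (use neg lebesgue_integral_eq_integral[OF if' Z] in auto)
  then have "(\<gamma> * DIM('a) - growth * p) * integral\<^sup>L (lebesgue_on Z) u \<le> 0" by simp
  with small have "integral\<^sup>L (lebesgue_on Z) u \<le> 0" by (simp add: mult_le_0_iff)
  then have uZ: "integral Z u \<le> 0" using lebesgue_integral_eq_integral[OF iu Z] by simp
  \<comment> \<open>A closed box with nonempty interior that contains the point: continuity and a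
    zero integral force \<open>u\<close> to vanish on all of it, including the end times 0 and
    \<open>T\<close>.\<close>
  obtain a :: 'a where a: "cball 0 (norm y + 1) \<subseteq> box (- a) a"
    using bounded_subset_box_symmetric[OF bounded_cball] .
  let ?B = "cbox (- a, 0) (a, T)"
  have ic: "u integrable_on ?B" by (intro integrable_continuous cu)
  have "integral ?B u \<le> integral Z u"
    by (rule integral_subset_le[OF _ ic integrable_on_lebesgue_on[OF iu Z]])
      (auto simp: Z_def cbox_Pair_eq u0)
  moreover have "integral ?B u \<ge> 0" by (rule integral_nonneg[OF ic]) (simp add: u0)
  ultimately have "integral ?B u = 0" using uZ by linarith
  then have "(u has_integral 0) ?B" using integrable_integral[OF ic] by simp
  then have "u (y, s) = 0"
  proof (rule has_integral_0_cbox_imp_0[OF cu u0])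
    have "y \<in> box (- a) a" using a by auto
    then have "(- a) \<bullet> i < a \<bullet> i" if "i \<in> Basis" for i
      using that by (force simp: mem_box)
    then show "box (- a, 0) (a, T) \<noteq> {}"
      using T by (auto simp: box_ne_empty Basis_prod_def)
    show "(y, s) \<in> ?B" using \<open>y \<in> box (- a) a\<close> box_subset_cbox s by (auto simp: cbox_Pair_eq)
  qed
  then show ?thesis by (simp add: u_def w_def)
qed

end

subsection \<open>Harmonic fields vanishing at infinity\<close>

text \<open>At the maximum \<open>g'\<close> is 0, and its positive derivative there makes
  \<open>g'\<close> positive just to the right, so \<open>g\<close> rises above its supposed
  maximum.\<close>

lemma not_local_max_if_second_derivative_pos:
  fixes g g' :: "real \<Rightarrow> real"
  assumes g: "\<And>t. (g has_real_derivative g' t) (at t)"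
    and g'': "(g' has_real_derivative c) (at 0)" and c: "c > 0"
    and d: "d > 0" and max: "\<And>t. \<bar>t\<bar> < d \<Longrightarrow> g t \<le> g 0"
  shows False
proof -
  have g0: "g' 0 = 0" by (rule DERIV_local_max[OF g d]) (use max in auto)
  obtain e where e: "e > 0" "\<And>h. h > 0 \<Longrightarrow> h < e \<Longrightarrow> g' 0 < g' (0 + h)"
    using DERIV_pos_inc_right[OF g'' c] by auto
  define t where "t = min d e / 2"
  have t: "0 < t" "t < d" "t < e" using d e(1) by (auto simp: t_def)
  obtain z where z: "0 < z" "z < t" "g t - g 0 = (t - 0) * g' z"
    using MVT2[OF t(1), of g g'] g by auto
  have "g' z > 0" using e(2)[of z] z t g0 by auto
  then have "t * g' z > 0" using t by simp
  then have "g t > g 0" using z by simp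
  with max[of t] t show False by auto
qed

text \<open>Maximum principle for \<open>u + \<epsilon> |y|\<^sup>2\<close>, whose Laplacian is strictly positive.\<close>

lemma harmonic_vanishing_at_infinity_le_0:
  fixes u :: "'a::euclidean_space \<Rightarrow> real"
  assumes u: "\<And>y. (u has_derivative blinfun_apply (u' y)) (at y)"
    and u'': "\<And>y. (u' has_derivative u'' y) (at y)"
    and harm: "\<And>y. (\<Sum>i\<in>Basis. blinfun_apply (u'' y i) i) = 0"
    and lim: "(u \<longlongrightarrow> 0) at_infinity"
  shows "u y0 \<le> 0"
proof (rule ccontr)
  assume "\<not> u y0 \<le> 0"
  then have pos: "u y0 > 0" by simp
  define \<delta> where "\<delta> = u y0"
  have "\<forall>\<^sub>F x in at_infinity. dist (u x) 0 < \<delta> / 2"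
    by (rule tendstoD[OF lim]) (use pos in \<open>simp add: \<delta>_def\<close>)
  then obtain R0 where R0: "\<And>x. norm x \<ge> R0 \<Longrightarrow> \<bar>u x\<bar> < \<delta> / 2"
    unfolding eventually_at_infinity dist_real_def diff_0_right by blast
  define R where "R = \<bar>R0\<bar> + norm y0 + 1"
  have R: "R > 0" "R \<ge> R0" "norm y0 < R" using norm_ge_zero[of y0] unfolding R_def by linarith+
  \<comment> \<open>With this choice \<epsilon> times \<open>R\<^sup>2\<close> is \<delta> / 4. On
    the sphere of radius \<open>R\<close> the perturbed function is then below 3 \<delta> / 4, while
    at \<open>y0\<close> it is at least \<delta>, so its maximum over the ball is interior.\<close>
  define \<epsilon> where "\<epsilon> = \<delta> / (4 * R\<^sup>2)"
  have eps: "\<epsilon> > 0" "\<epsilon> * R\<^sup>2 = \<delta> / 4" using pos R by (auto simp: \<epsilon>_def \<delta>_def)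
  define v where "v = (\<lambda>x. u x + \<epsilon> * (x \<bullet> x))"
  have cu: "continuous_on S u" for S
    using u by (intro continuous_at_imp_continuous_on) (auto intro: has_derivative_continuous)
  have "\<exists>x\<in>cball 0 R. \<forall>y\<in>cball 0 R. v y \<le> v x"
    unfolding v_def using R by (intro continuous_attains_sup) (auto intro!: continuous_intros cu)
  then obtain x where x: "x \<in> cball 0 R" and mx: "\<And>y. y \<in> cball 0 R \<Longrightarrow> v y \<le> v x" by blast
  have "v x \<ge> v y0" using R by (intro mx) auto
  moreover have "v y0 \<ge> \<delta>" using eps by (simp add: v_def \<delta>_def)
  ultimately have vx: "v x \<ge> \<delta>" by simp
  have xR: "norm x < R"
  proof (rule ccontr)
    assume "\<not> norm x < R"
    with x have n: "norm x = R" by simp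
    then have "v x < \<delta> / 2 + \<epsilon> * R\<^sup>2" using R0[of x] R(2) by (auto simp: v_def dot_square_norm)
    with vx eps pos show False by (simp add: \<delta>_def)
  qed
  \<comment> \<open>A positive Laplacian has a positive pure second derivative in some basis
    direction, which reduces the contradiction to one variable.\<close>
  have "(\<Sum>i\<in>Basis. blinfun_apply (u'' x i) i + 2 * \<epsilon>) > 0"
    using harm[of x] eps by (simp add: sum.distrib)
  then obtain i :: 'a where i: "i \<in> Basis" "blinfun_apply (u'' x i) i + 2 * \<epsilon> > 0"
    by (metis (no_types, lifting) not_le sum_nonpos)
  define g where "g = (\<lambda>t. v (x + t *\<^sub>R i))"
  define g' where "g' = (\<lambda>t. blinfun_apply (u' (x + t *\<^sub>R i)) i + 2 * \<epsilon> * ((x + t *\<^sub>R i) \<bullet> i))"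
  have line: "((\<lambda>t. x + t *\<^sub>R i) has_derivative (\<lambda>k. k *\<^sub>R i)) (at t)" for t
    by (auto intro!: derivative_eq_intros)
  have dg: "(g has_real_derivative g' t) (at t)" for t
  proof -
    have "((\<lambda>t. (x + t *\<^sub>R i) \<bullet> (x + t *\<^sub>R i)) has_derivative (\<lambda>k. 2 * (((x + t *\<^sub>R i) \<bullet> i) * k))) (at t)"
      using has_derivative_inner[OF line line]
      by (rule has_derivative_eq_rhs) (auto simp: fun_eq_iff inner_commute algebra_simps)
    from has_derivative_add[OF has_derivative_compose[OF line u] has_derivative_mult_right[OF this, of \<epsilon>]]
    show ?thesis unfolding has_field_derivative_def g_def v_def
      by (rule has_derivative_eq_rhs)
        (auto simp: fun_eq_iff g'_def blinfun.bilinear_simps algebra_simps)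
  qed
  have dg': "(g' has_real_derivative blinfun_apply (u'' x i) i + 2 * \<epsilon>) (at 0)"
  proof -
    have "((\<lambda>t. u' (x + t *\<^sub>R i)) has_derivative (\<lambda>k. u'' x (k *\<^sub>R i))) (at 0)"
      using has_derivative_compose[OF line[of 0], of u' "u'' x"] u'' by simp
    from bounded_linear.has_derivative[OF blinfun.bounded_linear_left this]
    have 1: "((\<lambda>t. blinfun_apply (u' (x + t *\<^sub>R i)) i) has_derivative
        (\<lambda>k. blinfun_apply (u'' x (k *\<^sub>R i)) i)) (at 0)" .
    have 2: "((\<lambda>t. 2 * \<epsilon> * ((x + t *\<^sub>R i) \<bullet> i)) has_derivative (\<lambda>k. 2 * \<epsilon> * k)) (at 0)"
      using i by (auto intro!: derivative_eq_intros simp: inner_Basis)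
    have "u'' x (k *\<^sub>R i) = k *\<^sub>R u'' x i" for k
      using has_derivative_linear[OF u''] by (rule linear_cmul)
    then show ?thesis unfolding has_field_derivative_def g'_def
      by (intro has_derivative_eq_rhs[OF has_derivative_add[OF 1 2]])
        (auto simp: fun_eq_iff blinfun.bilinear_simps algebra_simps)
  qed
  show False
  proof (rule not_local_max_if_second_derivative_pos[OF dg dg' i(2)])
    show "R - norm x > 0" using xR by simp
    fix t :: real assume "\<bar>t\<bar> < R - norm x"
    then have "norm (x + t *\<^sub>R i) \<le> R" using norm_triangle_ineq[of x "t *\<^sub>R i"] i(1) by simp
    then show "g t \<le> g 0" unfolding g_def by (auto intro!: mx)
  qed
qed

text \<open>Exchanging \<open>i\<close> and \<open>j\<close> by the vanishing curl and then the two
  slots of \<open>U''\<close> by symmetry turns the Laplacian of a component into a derivative of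
  the divergence. So each component is harmonic, and the one-sided maximum principle is applied to
  it and to its negative.\<close>

lemma curl_free_divergence_free_eq_0:
  fixes U :: "'a::euclidean_space \<Rightarrow> 'a"
  assumes U: "\<And>y. (U has_derivative blinfun_apply (U' y)) (at y)"
    and U': "\<And>y. (U' has_derivative blinfun_apply (U'' y)) (at y)"
    and div: "\<And>y. (\<Sum>i\<in>Basis. U' y i \<bullet> i) = 0"
    and curl: "\<And>y i j. i \<in> Basis \<Longrightarrow> j \<in> Basis \<Longrightarrow> U' y i \<bullet> j = U' y j \<bullet> i"
    and lim: "(U \<longlongrightarrow> 0) at_infinity"
  shows "U y = 0"
proof -
  have sym: "U'' y u v = U'' y v u" for y u v by (rule symmetric_second_derivative[OF U U'])
  have D: "((\<lambda>x. U' x u \<bullet> v) has_derivative (\<lambda>h. U'' y h u \<bullet> v)) (at y)" for y u v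
    by (intro has_derivative_inner_left bounded_linear.has_derivative[OF blinfun.bounded_linear_left U'])
  have curl': "U'' y h i \<bullet> j = U'' y h j \<bullet> i" if "i \<in> Basis" "j \<in> Basis" for y h i j
  proof -
    have "((\<lambda>x. U' x i \<bullet> j) has_derivative (\<lambda>h. U'' y h j \<bullet> i)) (at y)"
      using D[of j i y] curl[OF that] by simp
    from has_derivative_unique[OF D this] show ?thesis by metis
  qed
  have lap: "(\<Sum>i\<in>Basis. U'' y i i \<bullet> j) = 0" if "j \<in> Basis" for y j
  proof -
    have "(\<Sum>i\<in>Basis. U'' y i i \<bullet> j) = (\<Sum>i\<in>Basis. U'' y j i \<bullet> i)"
    proof (rule sum.cong)
      fix i :: 'a assume i: "i \<in> Basis"
      show "U'' y i i \<bullet> j = U'' y j i \<bullet> i" using curl'[OF i that, of y i] sym[of y i j] by simp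
    qed simp
    also have "\<dots> = 0"
    proof -
      have "((\<lambda>x. \<Sum>i\<in>Basis. U' x i \<bullet> i) has_derivative (\<lambda>h. \<Sum>i\<in>Basis. U'' y h i \<bullet> i)) (at y)"
        by (intro has_derivative_sum D)
      then have "((\<lambda>x. 0::real) has_derivative (\<lambda>h. \<Sum>i\<in>Basis. U'' y h i \<bullet> i)) (at y)"
        unfolding div .
      from has_derivative_unique[OF this has_derivative_const] show ?thesis by metis
    qed
    finally show ?thesis .
  qed
  have le: "U y \<bullet> (c *\<^sub>R j) \<le> 0" if j: "j \<in> Basis" for y j c
  proof (rule harmonic_vanishing_at_infinity_le_0[where u = "\<lambda>y. U y \<bullet> (c *\<^sub>R j)"])
    show "((\<lambda>y. U y \<bullet> (c *\<^sub>R j)) has_derivative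
        blinfun_apply (blinfun_inner_left (c *\<^sub>R j) o\<^sub>L U' y)) (at y)" for y
      by (rule has_derivative_eq_rhs[OF has_derivative_inner_left[OF U]])
        (simp add: fun_eq_iff inner_commute)
    show "((\<lambda>y. blinfun_inner_left (c *\<^sub>R j) o\<^sub>L U' y) has_derivative
        (\<lambda>h. blinfun_inner_left (c *\<^sub>R j) o\<^sub>L U'' y h)) (at y)" for y
      by (rule bounded_linear.has_derivative[OF
          bounded_bilinear.bounded_linear_right[OF bounded_bilinear_blinfun_compose] U'])
    show "(\<Sum>i\<in>Basis. blinfun_apply (blinfun_inner_left (c *\<^sub>R j) o\<^sub>L U'' y i) i) = 0" for y
      using lap[OF j, of y] by (simp add: inner_commute flip: sum_distrib_left)
    show "((\<lambda>y. U y \<bullet> (c *\<^sub>R j)) \<longlongrightarrow> 0) at_infinity"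
      using tendsto_inner[OF lim tendsto_const, of "c *\<^sub>R j"] by simp
  qed
  show ?thesis
  proof (rule euclidean_eqI)
    fix j :: 'a assume "j \<in> Basis"
    from le[OF this, of y 1] le[OF this, of y "-1"] show "U y \<bullet> j = 0 \<bullet> j" by simp
  qed
qed

section \<open>Coordinates in dimension three, periodicity, and the final application\<close>

lemma Basis_real_vec: "(Basis :: (real^'n) set) = range (\<lambda>k. axis k 1)"
  by (auto simp: Basis_vec_def)

lemma sum_Basis_real_vec: "(\<Sum>i\<in>(Basis :: (real^'n) set). f i) = (\<Sum>k\<in>UNIV. f (axis k 1))"
  unfolding Basis_real_vec by (subst sum.reindex) (auto simp: inj_on_def axis_eq_axis)

lemma linear_sum_axis:
  fixes f :: "real^'n \<Rightarrow> 'b::real_vector"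
  assumes "linear f"
  shows "f x = (\<Sum>k\<in>UNIV. (x $ k) *\<^sub>R f (axis k 1))"
proof -
  have "f x = f (\<Sum>k\<in>UNIV. (x $ k) *\<^sub>R axis k 1)"
    using basis_expansion[of x] by (simp add: scalar_mult_eq_scaleR)
  then show ?thesis using assms by (simp add: linear_sum linear_cmul)
qed

lemma periodic_int_shift:
  fixes f :: "real \<Rightarrow> 'b"
  assumes "\<And>s. f (s + T) = f s"
  shows "f (s + of_int k * T) = f s"
proof -
  have *: "f (s + of_nat n * T) = f s" for n s
  proof (induction n)
    case (Suc n)
    have "f (s + of_nat (Suc n) * T) = f ((s + of_nat n * T) + T)" by (simp add: algebra_simps)
    then show ?case using Suc assms by simp
  qed simp
  show ?thesis
  proof (cases "k \<ge> 0")
    case True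
    then show ?thesis using *[of s "nat k"] by simp
  next
    case False
    then show ?thesis using *[of "s + of_int k * T" "nat (- k)"] by simp
  qed
qed

lemma partial_eq:
  assumes "(U has_derivative U') (at y)"
  shows "partial j U y = U' (axis j 1)"
  using frechet_derivative_at[OF assms] by (simp add: partial_def)

theorem theorem2p1:
  fixes \<alpha> S\<^sub>0 r :: real
    and V :: "real^3 \<Rightarrow> real \<Rightarrow> real^3"
    and P :: "real^3 \<Rightarrow> real \<Rightarrow> real"
  assumes "\<alpha> > -1"
    and "S\<^sub>0 > 0"
    and "C2x_C1t V"
    and "\<And>y s. V y (s + S\<^sub>0) = V y s"
    and "self_similar_euler \<alpha> V P"
    and "\<And>j. bounded (range (\<lambda>(y, s). partial j (\<lambda>x. V x s) y))"
    and "\<And>s. s \<in> {0..<S\<^sub>0} \<Longrightarrow> ((\<lambda>y. V y s) \<longlongrightarrow> 0) at_infinity"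
    and "r > 0"
    and "\<And>q. 0 < q \<Longrightarrow> q < r \<Longrightarrow>
           in_Lq q (UNIV \<times> {0..S\<^sub>0}) (\<lambda>(y, s). curl (\<lambda>x. V x s) y)"
  shows "\<forall>y s. V y s = 0"
proof -
  obtain Vs DV D2V where
    Vs: "\<And>y s. ((\<lambda>t. V y t) has_vector_derivative Vs y s) (at s)" and
    V: "\<And>y s. ((\<lambda>x. V x s) has_derivative blinfun_apply (DV y s)) (at y)" and
    DV: "\<And>y s. ((\<lambda>x. DV x s) has_derivative blinfun_apply (D2V y s)) (at y)" and
    cont: "continuous_on UNIV (\<lambda>(y, s). Vs y s)" "continuous_on UNIV (\<lambda>(y, s). DV y s)"
      "continuous_on UNIV (\<lambda>(y, s). D2V y s)"
    using assms(3) unfolding C2x_C1t_def by blast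
  have part: "partial j (\<lambda>x. V x s) y = DV y s (axis j 1)" for j s y
    by (rule partial_eq[OF V])
  have adv: "advect w (\<lambda>x. V x s) y = DV y s w" for w s y
    unfolding advect_def part
    by (rule linear_sum_axis[symmetric]) (rule bounded_linear.linear[OF blinfun.bounded_linear_right])
  define \<beta> \<gamma> where "\<beta> = \<alpha> / (\<alpha> + 1)" and "\<gamma> = 1 / (\<alpha> + 1)"
  obtain M where M: "\<And>j y s. norm (DV y s (axis j 1)) \<le> M"
  proof -
    have "\<forall>j. \<exists>b. \<forall>y s. norm (DV y s (axis j 1)) \<le> b"
      using assms(6) unfolding bounded_iff by (auto simp: part)
    from choice[OF this] obtain b where b: "\<And>j y s. norm (DV y s (axis j 1)) \<le> b j" by blast
    have "norm (DV y s (axis j 1)) \<le> Max (range b)" for j y s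
      by (rule order_trans[OF b]) simp
    then show ?thesis by (rule that)
  qed
  interpret self_similar_flow V Vs P DV D2V \<beta> \<gamma> M
  proof
    show "\<beta> + \<gamma> = 1" "\<gamma> > 0" using assms(1) by (auto simp: \<beta>_def \<gamma>_def field_simps)
    show "(\<Sum>i\<in>Basis. DV y s i \<bullet> i) = 0" for y s
      using assms(5) unfolding self_similar_euler_def divergence_def part
      by (simp add: sum_Basis_real_vec inner_axis)
    show "norm (DV y s i) \<le> M" if "i \<in> Basis" for y s i
      using that M by (auto simp: Basis_real_vec)
    show "((\<lambda>x. P x s) has_derivative
      (\<lambda>h. - (Vs y s + (\<beta> *\<^sub>R V y s + DV y s (\<gamma> *\<^sub>R y + V y s))) \<bullet> h)) (at y)" for y s
    proof -
      have P: "((\<lambda>x. P x s) has_derivative frechet_derivative (\<lambda>x. P x s) (at y)) (at y)"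
        using assms(5) unfolding self_similar_euler_def frechet_derivative_works by blast
      have "grad (\<lambda>x. P x s) y = - (Vs y s + (\<beta> *\<^sub>R V y s + DV y s (\<gamma> *\<^sub>R y + V y s)))"
      proof -
        have "vector_derivative (\<lambda>t. V y t) (at s) = Vs y s"
          using Vs by (rule vector_derivative_at)
        moreover have "vector_derivative (\<lambda>t. V y t) (at s) + \<beta> *\<^sub>R V y s + \<gamma> *\<^sub>R DV y s y
            + DV y s (V y s) = - grad (\<lambda>x. P x s) y"
          using assms(5) unfolding self_similar_euler_def adv \<beta>_def \<gamma>_def by blast
        ultimately have "grad (\<lambda>x. P x s) y
            = - (Vs y s + \<beta> *\<^sub>R V y s + \<gamma> *\<^sub>R DV y s y + DV y s (V y s))"
          by simp
        then show ?thesis by (simp add: blinfun.bilinear_simps)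
      qed
      moreover have "frechet_derivative (\<lambda>x. P x s) (at y) h = grad (\<lambda>x. P x s) y \<bullet> h" for h
        unfolding linear_sum_axis[OF has_derivative_linear[OF P], of h]
        by (simp add: grad_def partial_def inner_vec_def mult.commute)
      ultimately have "frechet_derivative (\<lambda>x. P x s) (at y)
          = (\<lambda>h. - (Vs y s + (\<beta> *\<^sub>R V y s + DV y s (\<gamma> *\<^sub>R y + V y s))) \<bullet> h)"
        by (simp add: fun_eq_iff)
      then show ?thesis using P by simp
    qed
  qed (fact Vs V DV cont)+
  have enst: "enstrophy y s = 2 * (norm (curl (\<lambda>x. V x s) y))\<^sup>2" for y s
  proof -
    have v: "vort (axis i 1) (axis j 1) y s = DV y s (axis i 1) $ j - DV y s (axis j 1) $ i" for i j
      by (simp add: vort_def inner_axis)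
    have n: "(norm x)\<^sup>2 = (x $ 1)\<^sup>2 + (x $ 2)\<^sup>2 + (x $ 3)\<^sup>2" for x :: "real^3"
      unfolding power2_norm_eq_inner inner_vec_def by (simp add: sum_3 power2_eq_square)
    show ?thesis
      unfolding enstrophy_def sum_Basis_real_vec v n curl_def part sum_3 vector_3
      by (simp add: power2_eq_square algebra_simps)
  qed
  have "M \<ge> 0" by (rule order_trans[OF norm_ge_zero M[OF SOME_Basis]])
  then have g: "growth > 0" by (simp add: growth_def add_pos_nonneg)
  \<comment> \<open>The enstrophy is raised to the power \<open>q / 2\<close>, matching the power
    \<open>q\<close> of the curl. The bound \<open>\<gamma> * 3 / growth\<close> makes
    \<open>growth * (q / 2)\<close> at most half of \<open>\<gamma> * 3\<close>, hence strictly
    smaller, and \<open>r / 2\<close> keeps \<open>q\<close> strictly below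
    \<open>r\<close>.\<close>
  define q where "q = min (r / 2) (min 1 (\<gamma> * 3 / growth))"
  have q: "0 < q" "q < r" "q \<le> 1" "q \<le> \<gamma> * 3 / growth"
    using g \<gamma> \<open>r > 0\<close> by (auto simp: q_def min_less_iff_disj)
  have vanish: "enstrophy y s = 0" if "s \<in> {0..S\<^sub>0}" for y s
  proof (rule enstrophy_eq_0[where p = "q / 2", OF _ assms(2) _ _ _ _ that])
    show "V y S\<^sub>0 = V y 0" for y using assms(4)[of y 0] by simp
    show "growth * (q / 2) < \<gamma> * DIM(real^3)" using q g \<gamma> by (simp add: field_simps)
    have "integrable (lebesgue_on (UNIV \<times> {0..S\<^sub>0}))
        (\<lambda>z. norm ((\<lambda>(y, s). curl (\<lambda>x. V x s) y) z) powr q)"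
      using assms(9)[OF q(1,2)] unfolding in_Lq_def by blast
    from integrable_mult_right[OF this, of "2 powr (q / 2)"]
    show "integrable (lebesgue_on (UNIV \<times> {0..S\<^sub>0})) (\<lambda>(y, s). enstrophy y s powr (q / 2))"
    proof (rule back_subst[where P = "integrable _"], intro ext, clarify)
      fix y s
      let ?n = "norm (curl (\<lambda>x. V x s) y)"
      have "(?n\<^sup>2) powr (q / 2) = ?n powr q"
        by (cases "?n = 0") (simp_all add: powr_powr flip: powr_numeral)
      then show "2 powr (q / 2) * norm (curl (\<lambda>x. V x s) y) powr q = enstrophy y s powr (q / 2)"
        unfolding enst by (simp add: powr_mult)
    qed
  qed (use q in auto)
  have zero: "V y s = 0" if s: "s \<in> {0..<S\<^sub>0}" for y s
  proof (rule curl_free_divergence_free_eq_0[OF V DV div0 _ assms(7)[OF s]])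
    fix y i j :: "real^3" assume ij: "i \<in> Basis" "j \<in> Basis"
    have "(\<Sum>i\<in>Basis. \<Sum>j\<in>Basis. (vort i j y s)\<^sup>2) = 0"
      using vanish[of s y] s by (simp add: enstrophy_def)
    then have "(vort i j y s)\<^sup>2 = 0"
      using ij by (simp add: sum_nonneg_eq_0_iff sum_nonneg)
    then show "DV y s i \<bullet> j = DV y s j \<bullet> i" by (simp add: vort_def)
  qed
  show ?thesis
  proof (intro allI)
    fix y s
    \<comment> \<open>Decay at infinity is given only for times in \<open>{0..<S\<^sub>0}\<close>,
      so \<open>V\<close> is known to vanish there; this multiple of the period brings
      \<open>s\<close> back into that interval.\<close>
    have "s + of_int (- \<lfloor>s / S\<^sub>0\<rfloor>) * S\<^sub>0 \<in> {0..<S\<^sub>0}"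
    proof -
      have "of_int \<lfloor>s / S\<^sub>0\<rfloor> * S\<^sub>0 \<le> s"
        using of_int_floor_le[of "s / S\<^sub>0"] assms(2) by (simp only: pos_le_divide_eq)
      moreover have "s < (of_int \<lfloor>s / S\<^sub>0\<rfloor> + 1) * S\<^sub>0"
        using real_of_int_floor_add_one_gt[of "s / S\<^sub>0"] assms(2) by (simp only: pos_divide_less_eq)
      ultimately show ?thesis by (simp add: algebra_simps)
    qed
    from zero[OF this, of y] show "V y s = 0"
      unfolding periodic_int_shift[of "V y", OF assms(4)] .
  qed
qed

end
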